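(* Let $g$ be a conformally flat Riemannian metric on the torus $\mathbb{T}^n$, let $\beta$ be a closed 2-form on $\mathbb{T}^n$, and let $g^t$ be the magnetic geodesic flow of $(g,\beta)$ on $T^*\mathbb{T}^n$, i.e. the Hamiltonian flow of $H=\frac12\langle p,p\rangle_g$ with respect to the twisted symplectic form $\omega=\omega_0+\pi^*\beta$. If $\beta$ does not vanish identically, then there exists an orbit of $g^t$ on the energy level $\{H=1/2\}$ which has conjugate points.
   Context: All data are smooth. $\omega_0$ is the standard symplectic form on $T^*\mathbb{T}^n$ ($\omega_0=\sum_i dp_i\wedge dq_i$ in canonical coordinates), $\pi:T^*\mathbb{T}^n\to\mathbb{T}^n$ is the projection, and $\langle\cdot,\cdot\rangle_g$ is the inner product on covectors induced by $g$. Conformally flat: $g$ is (globally) conformal to a flat metric on the torus, i.e. $\mathbb{T}^n$ can be written as $\mathbb{R}^n/\Lambda$ for a lattice $\Lambda$, with linear coordinates $q=(q_1,\dots,q_n)$, such that $g=\frac1\lambda(dq_1^2+\cdots+dq_n^2)$ for some smooth positive function $\lambda$ on $\mathbb{T}^n$; equivalently $H(p,q)=\frac{\lambda(q)}2(p_1^2+\cdots+p_n^2)$. Conjugate points: for $x\in T^*\mathbb{T}^n$ let $V(x)=\ker d\pi_x\subset T_x(T^*\mathbb{T}^n)$ be the vertical subspace. An orbit $\vartheta$ of $g^t$ has no conjugate points if for every $x\in\vartheta$ and every $t\neq0$, with $y=g^t(x)$, the subspaces $g^t_*V(x)$ and $V(y)$ of $T_y(T^*\mathbb{T}^n)$ are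 transversal (equivalently, intersect only in $0$). Otherwise the orbit has conjugate points. *)

theory Defs
  imports "HOL-Analysis.Analysis"
begin

section \<open>Smooth maps and tori\<close>

text \<open>
  On finite-dimensional spaces: \<open>f\<close> is of class \<open>C\<^sup>k\<^sup>+\<^sup>1\<close> iff it is differentiable and all its
  directional derivatives are of class \<open>C\<^sup>k\<close>.
\<close>

primrec C_k :: "nat \<Rightarrow> ('a::real_normed_vector \<Rightarrow> 'b::real_normed_vector) \<Rightarrow> bool" where
  "C_k 0 f \<longleftrightarrow> continuous_on UNIV f"
| "C_k (Suc k) f \<longleftrightarrow>
     f differentiable_on UNIV \<and> (\<forall>v. C_k k (\<lambda>x. frechet_derivative f (at x) v))"

definition smooth :: "('a::real_normed_vector \<Rightarrow> 'b::real_normed_vector) \<Rightarrow> bool" where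
  "smooth f \<longleftrightarrow> (\<forall>k. C_k k f)"

definition lattice :: "(real ^ 'n) set \<Rightarrow> bool" where
  "lattice L \<longleftrightarrow>
     (\<exists>B. independent B \<and> span B = UNIV \<and>
          L = {\<Sum>b\<in>B. of_int (c b) *\<^sub>R b |c. (c :: real ^ 'n \<Rightarrow> int) \<in> UNIV})"

text \<open>
  The torus is \<open>\<real>\<^sup>n / L\<close>. A function, metric or form on it is given by its \<open>L\<close>-periodic lift to
  \<open>\<real>\<^sup>n\<close>, in the linear coordinates \<open>q\<close>; all tangent spaces are identified with \<open>\<real>\<^sup>n\<close>.
\<close>

definition periodic :: "(real ^ 'n) set \<Rightarrow> (real ^ 'n \<Rightarrow> 'b) \<Rightarrow> bool" where
  "periodic L f \<longleftrightarrow> (\<forall>l\<in>L. \<forall>q. f (q + l) = f q)"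

type_synonym 'n tensor2 = "real ^ 'n \<Rightarrow> real ^ 'n \<Rightarrow> real ^ 'n \<Rightarrow> real"

definition smooth_tensor2 :: "(real ^ 'n::finite) set \<Rightarrow> 'n tensor2 \<Rightarrow> bool" where
  "smooth_tensor2 L T \<longleftrightarrow>
     periodic L T \<and> (\<forall>q. bilinear (T q)) \<and> (\<forall>u v. smooth (\<lambda>q. T q u v))"

definition riemannian_metric :: "(real ^ 'n::finite) set \<Rightarrow> 'n tensor2 \<Rightarrow> bool" where
  "riemannian_metric L g \<longleftrightarrow>
     smooth_tensor2 L g \<and> (\<forall>q u v. g q u v = g q v u) \<and> (\<forall>q u. u \<noteq> 0 \<longrightarrow> g q u u > 0)"

definition conformally_flat :: "(real ^ 'n::finite) set \<Rightarrow> 'n tensor2 \<Rightarrow> bool" where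
  "conformally_flat L g \<longleftrightarrow>
     (\<exists>lam :: real ^ 'n \<Rightarrow> real. smooth lam \<and> periodic L lam \<and> (\<forall>q. lam q > 0) \<and>
        (\<forall>q u v. g q u v = (1 / lam q) * (u \<bullet> v)))"

definition two_form :: "(real ^ 'n::finite) set \<Rightarrow> 'n tensor2 \<Rightarrow> bool" where
  "two_form L \<beta> \<longleftrightarrow> smooth_tensor2 L \<beta> \<and> (\<forall>q u. \<beta> q u u = 0)"

text \<open>
  Invariant formula for the exterior derivative, evaluated on constant (hence commuting)
  vector fields \<open>u\<close>, \<open>v\<close>, \<open>w\<close>.
\<close>

definition ext_deriv :: "'n::finite tensor2 \<Rightarrow> real ^ 'n \<Rightarrow> real ^ 'n \<Rightarrow> real ^ 'n \<Rightarrow> real ^ 'n \<Rightarrow> real" where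
  "ext_deriv \<beta> q u v w =
     frechet_derivative (\<lambda>x. \<beta> x v w) (at q) u
   - frechet_derivative (\<lambda>x. \<beta> x u w) (at q) v
   + frechet_derivative (\<lambda>x. \<beta> x u v) (at q) w"

definition closed_form :: "'n::finite tensor2 \<Rightarrow> bool" where
  "closed_form \<beta> \<longleftrightarrow> (\<forall>q u v w. ext_deriv \<beta> q u v w = 0)"

section \<open>The magnetic geodesic flow\<close>

text \<open>
  A point of the cotangent bundle of \<open>\<real>\<^sup>n\<close> is a pair \<open>(q, p)\<close>, where the vector \<open>p\<close> stands for the
  covector \<open>u \<mapsto> p \<bullet> u\<close>, that is \<open>\<Sum>\<^sub>i p\<^sub>i dq\<^sub>i\<close>. The cotangent bundle of the torus is the quotient by
  translations \<open>(q, p) \<mapsto> (q + l, p)\<close> with \<open>l\<close> in the lattice.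
\<close>

type_synonym 'n phase = "(real ^ 'n) \<times> (real ^ 'n)"

definition proj :: "'n::finite phase \<Rightarrow> real ^ 'n" where
  "proj x = fst x"

definition sharp :: "'n::finite tensor2 \<Rightarrow> real ^ 'n \<Rightarrow> real ^ 'n \<Rightarrow> real ^ 'n" where
  "sharp g q p = (THE u. \<forall>v. g q u v = p \<bullet> v)"

definition cometric :: "'n::finite tensor2 \<Rightarrow> real ^ 'n \<Rightarrow> real ^ 'n \<Rightarrow> real ^ 'n \<Rightarrow> real" where
  "cometric g q p p' = g q (sharp g q p) (sharp g q p')"

definition kinetic_energy :: "'n::finite tensor2 \<Rightarrow> 'n phase \<Rightarrow> real" where
  "kinetic_energy g x = (1 / 2) * cometric g (fst x) (snd x) (snd x)"

text \<open>In \<open>\<omega>\<^sub>0\<close> the components of a tangent vector \<open>w\<close> are \<open>dq w = fst w\<close> and \<open>dp w = snd w\<close>.\<close>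

definition omega0 :: "'n::finite phase \<Rightarrow> 'n phase \<Rightarrow> 'n phase \<Rightarrow> real" where
  "omega0 x w w' = (\<Sum>i\<in>UNIV. snd w $ i * fst w' $ i - fst w $ i * snd w' $ i)"

definition pullback_proj :: "'n::finite tensor2 \<Rightarrow> 'n phase \<Rightarrow> 'n phase \<Rightarrow> 'n phase \<Rightarrow> real" where
  "pullback_proj \<beta> x w w' =
     \<beta> (proj x) (frechet_derivative proj (at x) w) (frechet_derivative proj (at x) w')"

definition twisted_form :: "'n::finite tensor2 \<Rightarrow> 'n phase \<Rightarrow> 'n phase \<Rightarrow> 'n phase \<Rightarrow> real" where
  "twisted_form \<beta> x w w' = omega0 x w w' + pullback_proj \<beta> x w w'"

text \<open>
  Sign convention \<open>\<omega>(\<cdot>, X) = dH\<close>, which for \<open>\<omega>\<^sub>0\<close> gives \<open>q' = \<partial>H/\<partial>p\<close>, \<open>p' = - \<partial>H/\<partial>q\<close>. The opposite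
  convention only reverses time.
\<close>

definition hamiltonian_vf ::
    "('n::finite phase \<Rightarrow> 'n phase \<Rightarrow> 'n phase \<Rightarrow> real) \<Rightarrow> ('n phase \<Rightarrow> real) \<Rightarrow> 'n phase \<Rightarrow> 'n phase" where
  "hamiltonian_vf \<omega> H x = (THE \<xi>. \<forall>w. \<omega> x w \<xi> = frechet_derivative H (at x) w)"

definition is_flow :: "('a::real_normed_vector \<Rightarrow> 'a) \<Rightarrow> (real \<Rightarrow> 'a \<Rightarrow> 'a) \<Rightarrow> bool" where
  "is_flow X \<Phi> \<longleftrightarrow>
     smooth (\<lambda>(t, x). \<Phi> t x) \<and>
     (\<forall>x. \<Phi> 0 x = x) \<and> (\<forall>s t x. \<Phi> (s + t) x = \<Phi> s (\<Phi> t x)) \<and>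
     (\<forall>t x. ((\<lambda>s. \<Phi> s x) has_vector_derivative X (\<Phi> t x)) (at t))"

text \<open>
  The flow is lifted to the cotangent bundle of \<open>\<real>\<^sup>n\<close>. The vector field is \<open>L\<close>-periodic, so the lift
  commutes with lattice translations and descends to the torus. The covering is a local
  diffeomorphism compatible with the projections, so an orbit on the torus and any lift of it
  have conjugate points simultaneously.
\<close>

definition magnetic_geodesic_flow ::
    "'n::finite tensor2 \<Rightarrow> 'n tensor2 \<Rightarrow> (real \<Rightarrow> 'n phase \<Rightarrow> 'n phase) \<Rightarrow> bool" where
  "magnetic_geodesic_flow g \<beta> \<Phi> \<longleftrightarrow>
     is_flow (hamiltonian_vf (twisted_form \<beta>) (kinetic_energy g)) \<Phi>"

section \<open>Conjugate points\<close>

definition orbit :: "(real \<Rightarrow> 'a \<Rightarrow> 'a) \<Rightarrow> 'a \<Rightarrow> 'a set" where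
  "orbit \<Phi> x = range (\<lambda>t. \<Phi> t x)"

definition vertical :: "'n::finite phase \<Rightarrow> 'n phase set" where
  "vertical x = {w. frechet_derivative proj (at x) w = 0}"

definition transversal :: "'a::real_vector set \<Rightarrow> 'a set \<Rightarrow> bool" where
  "transversal U W \<longleftrightarrow> {u + w |u w. u \<in> U \<and> w \<in> W} = UNIV"

definition has_conjugate_points ::
    "(real \<Rightarrow> 'n::finite phase \<Rightarrow> 'n phase) \<Rightarrow> 'n phase set \<Rightarrow> bool" where
  "has_conjugate_points \<Phi> \<theta> \<longleftrightarrow>
     \<not> (\<forall>x\<in>\<theta>. \<forall>t. t \<noteq> 0 \<longrightarrow>
          transversal (frechet_derivative (\<Phi> t) (at x) ` vertical x) (vertical (\<Phi> t x)))"

end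

theory Submission
  imports Defs
begin

text \<open>
  Hopf's argument. Let \<open>g = (1 / lam) dq\<^sup>2\<close>. If an orbit has no conjugate points, the images of the
  vertical spaces under the flow are graphs \<open>dp = A dq\<close>, and \<open>A\<close> solves a matrix Riccati equation.
  The graphs are Lagrangian for the twisted form, hence \<open>A - A\<^sup>T = B\<close>, the matrix of \<open>\<beta>\<close>. Taking the
  trace and completing the square gives, on the energy level \<open>1 / 2\<close>, a scalar inequality
  \<open>u' \<le> - c (u + r)\<^sup>2 - pot\<close> with \<open>r\<close> bounded, so the integral of \<open>pot\<close> over the energy level
  cannot be positive. But integration by parts shows that, in dimension at least two, this integral is
  at least that of \<open>lam |B|\<^sup>2 / 4\<close>: the terms containing \<open>\<beta>\<close> linearly are odd in \<open>p\<close> and drop out,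
  and those containing derivatives of \<open>lam\<close> only add up to a nonnegative quantity.

  The energy level is treated through homogeneous extension: functions on it are extended to be
  constant along the rays in \<open>p\<close> and integrated against a bump function of the energy, so that only
  Lebesgue integrals over boxes occur.
\<close>

section \<open>Continuously differentiable maps\<close>

text \<open>The magnetic force is linear in \<open>p\<close> and the geodesic force quadratic, so
  energy levels are not related by rescaling, and the contradiction hypothesis concerns one level
  only. This is why the dynamics of that level has to be transplanted to the neighbouring levels
  instead of averaging the true flow over a band of energies. The Riccati solution is the one
  issuing from the vertical space at time 0, not a global bounded solution obtained as a limit. It
  is singular at time 0 and no bound on it is at hand, so the inequality is tested on
  \<open>[1, 1 + T]\<close> with the square of a quadratic polynomial vanishing at both ends. The
  mean of the potential then appears with a factor of order \<open>T ^ 5\<close>, while completing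
  the square costs order \<open>T ^ 3\<close> and the bounded shift order \<open>T ^ 4\<close>; a
  large \<open>T\<close> decides. The dimension enters through one constant: after integration by
  parts the terms in the derivative of \<open>lam\<close> carry the factor
  \<open>n / 4 - 1 / 2\<close>. Closedness of the form enters through the Lagrangian property of the
  graphs.\<close>

definition C1 :: "('a::real_normed_vector \<Rightarrow> 'b::real_normed_vector) \<Rightarrow> bool" where
  "C1 f \<longleftrightarrow> (\<exists>f'. (\<forall>x. (f has_derivative f' x) (at x)) \<and> (\<forall>v. continuous_on UNIV (\<lambda>x. f' x v)))"

abbreviation D :: "('a::real_normed_vector \<Rightarrow> 'b::real_normed_vector) \<Rightarrow> 'a \<Rightarrow> 'a \<Rightarrow> 'b" where
  "D f x \<equiv> frechet_derivative f (at x)"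

lemma C1I:
  assumes "\<And>x. (f has_derivative f' x) (at x)" "\<And>v. continuous_on UNIV (\<lambda>x. f' x v)"
  shows "C1 f"
  using assms unfolding C1_def by blast

lemma D_eq: "(f has_derivative f') (at x) \<Longrightarrow> D f x = f'"
  by (rule frechet_derivative_at[symmetric])

lemma C1_has_derivative: "C1 f \<Longrightarrow> (f has_derivative D f x) (at x)"
proof -
  assume "C1 f"
  then obtain f' where f': "\<And>x. (f has_derivative f' x) (at x)"
    unfolding C1_def by blast
  show ?thesis using f'[of x] D_eq[OF f'[of x]] by simp
qed

lemma C1_continuous_D: "C1 f \<Longrightarrow> continuous_on UNIV (\<lambda>x. D f x v)"
proof -
  assume "C1 f"
  then obtain f' where f': "\<And>x. (f has_derivative f' x) (at x)" "\<And>v. continuous_on UNIV (\<lambda>x. f' x v)"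
    unfolding C1_def by blast
  have "D f x = f' x" for x using f'(1) D_eq by blast
  then show ?thesis using f'(2) by simp
qed

lemma C1_continuous: "C1 f \<Longrightarrow> continuous_on UNIV f"
  by (rule continuous_at_imp_continuous_on) (metis C1_has_derivative has_derivative_continuous)

lemma C1_bounded_linear_D: "C1 f \<Longrightarrow> bounded_linear (D f x)"
  by (rule has_derivative_bounded_linear[OF C1_has_derivative])

named_theorems C1_intros

lemma C1_const [C1_intros]: "C1 (\<lambda>x. c)"
  by (rule C1I[where f'="\<lambda>x v. 0"]) auto

lemma C1_bounded_linear: "bounded_linear f \<Longrightarrow> C1 f"
  by (rule C1I[where f'="\<lambda>x. f"]) (auto simp: bounded_linear_imp_has_derivative)

lemma C1_ident [C1_intros]: "C1 (\<lambda>x. x)"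
  by (simp add: C1_bounded_linear)

lemma C1_add [C1_intros]: "C1 f \<Longrightarrow> C1 g \<Longrightarrow> C1 (\<lambda>x. f x + g x)"
  by (rule C1I[where f'="\<lambda>x v. D f x v + D g x v"])
     (auto intro!: has_derivative_add C1_has_derivative continuous_on_add C1_continuous_D)

lemma C1_bilinear:
  assumes "bounded_bilinear b" "C1 f" "C1 g" shows "C1 (\<lambda>x. b (f x) (g x))"
proof (rule C1I[where f'="\<lambda>x v. b (f x) (D g x v) + b (D f x v) (g x)"])
  show "((\<lambda>x. b (f x) (g x)) has_derivative (\<lambda>v. b (f x) (D g x v) + b (D f x v) (g x))) (at x)" for x
    using bounded_bilinear.FDERIV[OF assms(1) C1_has_derivative[OF assms(2)] C1_has_derivative[OF assms(3)]] .
  show "continuous_on UNIV (\<lambda>x. b (f x) (D g x v) + b (D f x v) (g x))" for v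
    by (intro continuous_on_add bounded_bilinear.continuous_on[OF assms(1)] C1_continuous C1_continuous_D assms)
qed

lemmas C1_mult [C1_intros] = C1_bilinear[OF bounded_bilinear_mult]
lemmas C1_scaleR [C1_intros] = C1_bilinear[OF bounded_bilinear_scaleR]
lemmas C1_inner [C1_intros] = C1_bilinear[OF bounded_bilinear_inner]

lemma C1_minus [C1_intros]: "C1 f \<Longrightarrow> C1 (\<lambda>x. - f x)"
  using C1_scaleR[OF C1_const[of "-1"], of f] by simp

lemma C1_diff [C1_intros]: "C1 f \<Longrightarrow> C1 g \<Longrightarrow> C1 (\<lambda>x. f x - g x)"
  using C1_add[of f "\<lambda>x. - g x"] C1_minus by auto

lemma C1_sum [C1_intros]: "(\<And>i. i \<in> S \<Longrightarrow> C1 (f i)) \<Longrightarrow> C1 (\<lambda>x. \<Sum>i\<in>S. f i x)"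
  by (rule C1I[where f'="\<lambda>x v. \<Sum>i\<in>S. D (f i) x v"])
     (auto intro!: has_derivative_sum C1_has_derivative continuous_on_sum C1_continuous_D)

lemma C1_Pair [C1_intros]: "C1 f \<Longrightarrow> C1 g \<Longrightarrow> C1 (\<lambda>x. (f x, g x))"
  by (rule C1I[where f'="\<lambda>x v. (D f x v, D g x v)"])
     (auto intro!: has_derivative_Pair C1_has_derivative continuous_on_Pair C1_continuous_D)

lemma linear_euclidean_sum:
  fixes f :: "'a::euclidean_space \<Rightarrow> 'b::real_normed_vector"
  assumes "linear f" shows "f v = (\<Sum>k\<in>Basis. (v \<bullet> k) *\<^sub>R f k)"
proof -
  have "f v = f (\<Sum>k\<in>Basis. (v \<bullet> k) *\<^sub>R k)" by (simp add: euclidean_representation)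
  also have "\<dots> = (\<Sum>k\<in>Basis. (v \<bullet> k) *\<^sub>R f k)" by (simp add: linear_sum[OF assms] linear_scale[OF assms])
  finally show ?thesis .
qed

lemma C1_D_sum:
  fixes f :: "'a::euclidean_space \<Rightarrow> 'b::real_normed_vector"
  assumes "C1 f" shows "D f x v = (\<Sum>k\<in>Basis. (v \<bullet> k) *\<^sub>R D f x k)"
  by (rule linear_euclidean_sum) (simp add: C1_bounded_linear_D[OF assms] bounded_linear.linear)

text \<open>\<open>C1\<close> asks for continuity in the point for each fixed direction; in finite
  dimension, expanding the direction along \<open>Basis\<close> upgrades this to joint
  continuity.\<close>

lemma continuous_on_D:
  fixes f :: "'a::euclidean_space \<Rightarrow> 'b::real_normed_vector"
  assumes "C1 f" "continuous_on S a" "continuous_on S b"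
  shows "continuous_on S (\<lambda>x. D f (a x) (b x))"
proof -
  have "continuous_on S (\<lambda>x. D f (a x) k)" for k
    using continuous_on_compose2[OF C1_continuous_D[OF assms(1)] assms(2)] by auto
  then show ?thesis
    by (subst C1_D_sum[OF assms(1)]) (intro continuous_intros assms)
qed

lemma C1_compose:
  fixes g :: "'b::euclidean_space \<Rightarrow> 'c::real_normed_vector"
  assumes "C1 g" "C1 f" shows "C1 (\<lambda>x. g (f x))"
proof (rule C1I[where f'="\<lambda>x v. D g (f x) (D f x v)"])
  show "((\<lambda>x. g (f x)) has_derivative (\<lambda>v. D g (f x) (D f x v))) (at x)" for x
    by (rule has_derivative_compose[OF C1_has_derivative[OF assms(2)] C1_has_derivative[OF assms(1)]])
  show "continuous_on UNIV (\<lambda>x. D g (f x) (D f x v))" for v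
    by (rule continuous_on_D[OF assms(1) C1_continuous[OF assms(2)] C1_continuous_D[OF assms(2)]])
qed

lemma C1_fst [C1_intros]: "C1 f \<Longrightarrow> C1 (\<lambda>x. fst (f x))"
  by (rule C1I[where f'="\<lambda>x v. fst (D f x v)"])
     (auto intro!: has_derivative_fst C1_has_derivative continuous_on_fst C1_continuous_D)

lemma C1_snd [C1_intros]: "C1 f \<Longrightarrow> C1 (\<lambda>x. snd (f x))"
  by (rule C1I[where f'="\<lambda>x v. snd (D f x v)"])
     (auto intro!: has_derivative_snd C1_has_derivative continuous_on_snd C1_continuous_D)

lemma C1_vec_nth [C1_intros]: "C1 f \<Longrightarrow> C1 (\<lambda>x. f x $ i)"
  by (rule C1I[where f'="\<lambda>x v. D f x v $ i"])
     (auto intro!: bounded_linear.has_derivative[OF bounded_linear_vec_nth] C1_has_derivative 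
       continuous_on_component C1_continuous_D)

lemma bounded_linear_axis: "bounded_linear (axis i :: 'b::euclidean_space \<Rightarrow> 'b ^ 'n::finite)"
proof -
  have "linear (axis i :: 'b \<Rightarrow> 'b ^ 'n)"
    by (rule linearI) (auto simp: axis_def vec_eq_iff)
  then show ?thesis by (simp add: linear_conv_bounded_linear)
qed

lemma vec_eq_sum_axis: "x = (\<Sum>i\<in>UNIV. axis i (x $ i))" for x :: "'b::comm_monoid_add ^ 'n::finite"
  by (simp add: vec_eq_iff axis_def sum.delta')

lemma C1_vec_lambda [C1_intros]:
  fixes f :: "'n::finite \<Rightarrow> 'a::real_normed_vector \<Rightarrow> 'b::euclidean_space"
  assumes "\<And>i. C1 (f i)" shows "C1 (\<lambda>x. \<chi> i. f i x)"
proof -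
  have "C1 (\<lambda>x. \<Sum>i\<in>UNIV. axis i (f i x) :: 'b ^ 'n)"
    by (intro C1_sum C1_compose[OF C1_bounded_linear[OF bounded_linear_axis]] assms)
  also have "(\<lambda>x. \<Sum>i\<in>UNIV. axis i (f i x) :: 'b ^ 'n) = (\<lambda>x. \<chi> i. f i x)"
    by (rule ext) (simp add: vec_eq_iff axis_def sum.delta')
  finally show ?thesis .
qed

lemma bounded_bilinear_matrix_vector_mult:
  "bounded_bilinear (\<lambda>(A :: real ^ 'n::finite ^ 'm::finite) x. A *v x)"
proof -
  have "bilinear (\<lambda>(A :: real ^ 'n ^ 'm) x. A *v x)"
    unfolding bilinear_def linear_iff
    by (auto simp: matrix_vector_mult_def vec_eq_iff sum.distrib algebra_simps sum_distrib_left)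
  then show ?thesis by (simp add: bilinear_conv_bounded_bilinear)
qed

lemmas C1_matrix_vector_mult [C1_intros] = C1_bilinear[OF bounded_bilinear_matrix_vector_mult]

lemma C1_inverse [C1_intros]:
  fixes f :: "'a::real_normed_vector \<Rightarrow> real"
  assumes "C1 f" "\<And>x. f x \<noteq> 0" shows "C1 (\<lambda>x. inverse (f x))"
proof (rule C1I[where f'="\<lambda>x v. - (inverse (f x) * D f x v * inverse (f x))"])
  show "((\<lambda>x. inverse (f x)) has_derivative (\<lambda>v. - (inverse (f x) * D f x v * inverse (f x)))) (at x)" for x
    using Deriv.has_derivative_inverse[OF assms(2) C1_has_derivative[OF assms(1)]] by simp
qed (use assms(2) in \<open>auto intro!: continuous_intros C1_continuous[OF assms(1)] C1_continuous_D[OF assms(1)]\<close>)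

lemma C1_divide [C1_intros]:
  fixes f :: "'a::real_normed_vector \<Rightarrow> real"
  assumes "C1 f" "C1 g" "\<And>x. g x \<noteq> 0" shows "C1 (\<lambda>x. f x / g x)"
  using C1_mult[OF assms(1) C1_inverse[OF assms(2,3)]] by (simp add: divide_inverse)

lemma C1_power2 [C1_intros]:
  fixes f :: "'a::real_normed_vector \<Rightarrow> real"
  assumes "C1 f" shows "C1 (\<lambda>x. (f x)\<^sup>2)"
  using C1_mult[OF assms assms] by (simp add: power2_eq_square)

section \<open>Smooth maps and the symmetry of second derivatives\<close>

lemma smooth_D: "smooth f \<Longrightarrow> smooth (\<lambda>x. D f x v)"
  unfolding smooth_def using C_k.simps(2) by blast

lemma smooth_C1: "smooth f \<Longrightarrow> C1 f"
proof -
  assume s: "smooth f"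
  then have "C_k (Suc 0) f" unfolding smooth_def by blast
  then have *: "f differentiable_on UNIV" "\<And>v. continuous_on UNIV (\<lambda>x. D f x v)" by auto
  show ?thesis
    by (rule C1I[where f'="D f"])
       (use * in \<open>auto simp: differentiable_on_def frechet_derivative_works\<close>)
qed

lemma has_derivative_line:
  assumes "(f has_derivative f') (at (x + t *\<^sub>R v))"
  shows "((\<lambda>t. f (x + t *\<^sub>R v)) has_vector_derivative f' v) (at t within S)"
proof -
  have "((\<lambda>t. x + t *\<^sub>R v) has_derivative (\<lambda>s. s *\<^sub>R v)) (at t)"
    by (auto intro!: derivative_eq_intros)
  from has_derivative_compose[OF this assms]
  have "((\<lambda>t. f (x + t *\<^sub>R v)) has_derivative (\<lambda>s. f' (s *\<^sub>R v))) (at t)" .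
  moreover have "(\<lambda>s. f' (s *\<^sub>R v)) = (\<lambda>s. s *\<^sub>R f' v)"
    using assms has_derivative_linear linear_scale by blast
  ultimately show ?thesis
    by (simp add: has_vector_derivative_def has_derivative_at_withinI)
qed

lemma C1_line: "C1 f \<Longrightarrow> ((\<lambda>t. f (x + t *\<^sub>R v)) has_vector_derivative D f (x + t *\<^sub>R v) v) (at t within S)"
  by (rule has_derivative_line[OF C1_has_derivative])

text \<open>The increment of \<open>f\<close> in direction \<open>v\<close> is an integral of
  \<open>D f _ v\<close>. Differentiating it in direction \<open>u\<close> under the integral sign
  expresses \<open>D f (x + t *\<^sub>R v) u\<close> as an integral over \<open>{0..t}\<close>, and
  differentiating that at \<open>t = 0\<close> gives the symmetry. The last derivative is one-sided,
  which suffices for uniqueness.\<close>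

lemma second_derivative_symmetric:
  fixes f :: "'a::real_normed_vector \<Rightarrow> 'b::euclidean_space"
  assumes f: "C1 f" and f': "\<And>v. C1 (\<lambda>x. D f x v)"
  shows "D (\<lambda>x. D f x u) x v = D (\<lambda>x. D f x v) x u"
proof -
  define c where "c y = D (\<lambda>z. D f z v) y u" for y
  have cc: "continuous_on UNIV c" unfolding c_def by (rule C1_continuous_D[OF f'])
  have cD: "continuous_on UNIV (\<lambda>z. D f z v)" by (rule C1_continuous_D[OF f])
  have ftc: "f (x + s *\<^sub>R u + t *\<^sub>R v) = f (x + s *\<^sub>R u) + integral (cbox 0 t) (\<lambda>r. D f (x + r *\<^sub>R v + s *\<^sub>R u) v)"
    if "0 \<le> t" for s t
  proof -
    have "((\<lambda>r. D f (x + s *\<^sub>R u + r *\<^sub>R v) v) has_integral 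
        f (x + s *\<^sub>R u + t *\<^sub>R v) - f (x + s *\<^sub>R u + 0 *\<^sub>R v)) {0..t}"
      by (rule fundamental_theorem_of_calculus[OF that]) (rule C1_line[OF f])
    then have "integral {0..t} (\<lambda>r. D f (x + s *\<^sub>R u + r *\<^sub>R v) v) = f (x + s *\<^sub>R u + t *\<^sub>R v) - f (x + s *\<^sub>R u)"
      by (simp add: integral_unique)
    then show ?thesis by (simp add: add.commute add.left_commute)
  qed
  have key: "D f (x + t *\<^sub>R v) u = D f x u + integral {0..t} (\<lambda>r. c (x + r *\<^sub>R v))" if t: "0 \<le> t" for t
  proof -
    have L: "((\<lambda>s. integral (cbox 0 t) (\<lambda>r. D f (x + r *\<^sub>R v + s *\<^sub>R u) v)) has_vector_derivative
         integral (cbox 0 t) (\<lambda>r. c (x + r *\<^sub>R v + 0 *\<^sub>R u))) (at 0 within UNIV)"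
      by (rule leibniz_rule_vector_derivative)
         (auto simp: c_def split_beta intro!: integrable_continuous_real C1_line f' 
            continuous_on_compose2[OF cD] continuous_on_compose2[OF cc, unfolded c_def] continuous_intros)
    have "((\<lambda>s. f (x + s *\<^sub>R u) + integral (cbox 0 t) (\<lambda>r. D f (x + r *\<^sub>R v + s *\<^sub>R u) v))
       has_vector_derivative D f (x + 0 *\<^sub>R u) u + integral (cbox 0 t) (\<lambda>r. c (x + r *\<^sub>R v + 0 *\<^sub>R u))) (at 0)"
      by (rule has_vector_derivative_add[OF C1_line[OF f]]) (use L in simp)
    then have "((\<lambda>s. f (x + s *\<^sub>R u + t *\<^sub>R v)) has_vector_derivative 
        D f x u + integral (cbox 0 t) (\<lambda>r. c (x + r *\<^sub>R v))) (at 0)"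
      using ftc[OF t] by simp
    moreover have "((\<lambda>s. f ((x + t *\<^sub>R v) + s *\<^sub>R u)) has_vector_derivative D f (x + t *\<^sub>R v + 0 *\<^sub>R u) u) (at 0)"
      by (rule C1_line[OF f])
    then have "((\<lambda>s. f (x + s *\<^sub>R u + t *\<^sub>R v)) has_vector_derivative D f (x + t *\<^sub>R v) u) (at 0)"
      by (simp add: add.commute add.left_commute)
    ultimately show ?thesis using vector_derivative_unique_at by fastforce
  qed
  have ccl: "continuous_on {0..1} (\<lambda>r. c (x + r *\<^sub>R v))"
    by (rule continuous_on_compose2[OF cc]) (auto intro!: continuous_intros)
  have "((\<lambda>t. integral {0..t} (\<lambda>r. c (x + r *\<^sub>R v))) has_vector_derivative c (x + 0 *\<^sub>R v)) (at 0 within {0..1})"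
    by (rule integral_has_vector_derivative[OF ccl]) simp
  then have "((\<lambda>t. D f x u + integral {0..t} (\<lambda>r. c (x + r *\<^sub>R v))) has_vector_derivative 0 + c x) (at 0 within {0..1})"
    by (intro has_vector_derivative_add has_vector_derivative_const) simp
  then have "((\<lambda>t. D f (x + t *\<^sub>R v) u) has_vector_derivative c x) (at 0 within {0..1})"
    using has_vector_derivative_transform[of 0 "{0..1}" "\<lambda>t. D f (x + t *\<^sub>R v) u"] key by fastforce
  moreover have "((\<lambda>t. D f (x + t *\<^sub>R v) u) has_vector_derivative D (\<lambda>y. D f y u) (x + 0 *\<^sub>R v) v) (at 0 within {0..1})"
    by (rule C1_line[OF f'])
  ultimately show ?thesis
    unfolding c_def[symmetric]
    using vector_derivative_unique_within_closed_interval[of 0 1 0] by fastforce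
qed

section \<open>Integrals of periodic functions over boxes\<close>

lemma integral_translation:
  fixes f :: "'a::euclidean_space \<Rightarrow> real"
  assumes "continuous_on UNIV f"
  shows "integral (cbox a b) (\<lambda>x. f (x + c)) = integral (cbox (a + c) (b + c)) f"
proof -
  have "f integrable_on cbox (a + c) (b + c)"
    using assms continuous_on_subset integrable_continuous by blast
  from has_integral_affinity'[OF integrable_integral[OF this], of 1 c]
  show ?thesis by (simp add: integral_unique)
qed

text \<open>Periodicity is asked only on the slab of width \<open>h\<close> at the lower face: what
  leaves the box there must reappear at the upper face. This covers lattice directions as well as
  directions in which \<open>F\<close> vanishes near both faces. The enlarged box \<open>U\<close>
  is split once at the upper face of the box and once at the lower face of the shifted box.\<close>

lemma integral_translation_periodic_box:
  fixes F :: "'a::euclidean_space \<Rightarrow> real"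
  assumes F: "continuous_on UNIV F" and k: "k \<in> Basis" and h: "0 \<le> h" "h \<le> b \<bullet> k - a \<bullet> k"
    and per: "\<And>x. a \<bullet> k \<le> x \<bullet> k \<Longrightarrow> x \<bullet> k \<le> a \<bullet> k + h \<Longrightarrow> F (x + (b \<bullet> k - a \<bullet> k) *\<^sub>R k) = F x"
  shows "integral (cbox a b) (\<lambda>x. F (x + h *\<^sub>R k)) = integral (cbox a b) F"
proof -
  define l where "l = b \<bullet> k - a \<bullet> k"
  define U where "U = cbox a (b + h *\<^sub>R k)"
  have int: "F integrable_on cbox u v" for u v
    using F continuous_on_subset integrable_continuous by blast
  have ki: "i \<in> Basis \<Longrightarrow> k \<bullet> i = (if i = k then 1 else 0)" for i
    using k by (auto simp: inner_Basis)
  have s: "U \<inter> {x. x \<bullet> k \<le> b \<bullet> k} = cbox a b"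
    "U \<inter> {x. x \<bullet> k \<ge> b \<bullet> k} = cbox (a + l *\<^sub>R k) (b + h *\<^sub>R k)"
    "U \<inter> {x. x \<bullet> k \<le> a \<bullet> k + h} = cbox a (b + (h - l) *\<^sub>R k)"
    "U \<inter> {x. x \<bullet> k \<ge> a \<bullet> k + h} = cbox (a + h *\<^sub>R k) (b + h *\<^sub>R k)"
    using h k by (auto simp: U_def l_def mem_box inner_left_distrib ki split: if_splits)
      (smt (verit))+
  have "integral (cbox (a + l *\<^sub>R k) (b + h *\<^sub>R k)) F 
      = integral (cbox a (b + (h - l) *\<^sub>R k)) (\<lambda>x. F (x + l *\<^sub>R k))"
    by (subst integral_translation[OF F]) (simp add: algebra_simps)
  also have "\<dots> = integral (cbox a (b + (h - l) *\<^sub>R k)) F"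
  proof (rule integral_cong)
    fix x assume "x \<in> cbox a (b + (h - l) *\<^sub>R k)"
    then have "x \<in> U \<inter> {x. x \<bullet> k \<le> a \<bullet> k + h}" unfolding s .
    then show "F (x + l *\<^sub>R k) = F x"
      using per[of x] k by (auto simp: U_def l_def mem_box)
  qed
  finally have e: "integral (cbox (a + l *\<^sub>R k) (b + h *\<^sub>R k)) F = integral (cbox a (b + (h - l) *\<^sub>R k)) F" .
  have "integral U F = integral (cbox a b) F + integral (cbox (a + l *\<^sub>R k) (b + h *\<^sub>R k)) F"
    using integral_split[OF int k, of a "b + h *\<^sub>R k" "b \<bullet> k"] s(1,2) by (simp add: U_def)
  moreover have "integral U F = integral (cbox a (b + (h - l) *\<^sub>R k)) F + integral (cbox (a + h *\<^sub>R k) (b + h *\<^sub>R k)) F"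
    using integral_split[OF int k, of a "b + h *\<^sub>R k" "a \<bullet> k + h"] s(3,4) by (simp add: U_def)
  ultimately show ?thesis using e by (simp add: integral_translation[OF F])
qed

text \<open>The integral of the shifted function does not depend on a small shift; differentiation
  under the integral sign at shift 0 gives the claim.\<close>

lemma integral_derivative_periodic_box:
  fixes F :: "'a::euclidean_space \<Rightarrow> real"
  assumes F: "C1 F" and k: "k \<in> Basis" and e: "0 < e" "a \<bullet> k < b \<bullet> k"
    and per: "\<And>x. a \<bullet> k \<le> x \<bullet> k \<Longrightarrow> x \<bullet> k \<le> a \<bullet> k + e \<Longrightarrow> F (x + (b \<bullet> k - a \<bullet> k) *\<^sub>R k) = F x"
  shows "integral (cbox a b) (\<lambda>x. D F x k) = 0"
proof -
  define d where "d = min e (b \<bullet> k - a \<bullet> k)"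
  have d: "0 < d" "d \<le> e" "d \<le> b \<bullet> k - a \<bullet> k" using e by (auto simp: d_def)
  have cD: "continuous_on UNIV (\<lambda>x. D F x k)" by (rule C1_continuous_D[OF F])
  have "((\<lambda>h. integral (cbox a b) (\<lambda>x. F (x + h *\<^sub>R k))) has_vector_derivative 
      integral (cbox a b) (\<lambda>x. D F (x + 0 *\<^sub>R k) k)) (at 0 within {0..d})"
  proof (rule leibniz_rule_vector_derivative)
    show "((\<lambda>h. F (x + h *\<^sub>R k)) has_vector_derivative D F (x + h *\<^sub>R k) k) (at h within {0..d})" for h x
      by (rule C1_line[OF F])
    show "(\<lambda>x. F (x + h *\<^sub>R k)) integrable_on cbox a b" for h
      by (rule integrable_continuous, rule continuous_on_compose2[OF C1_continuous[OF F]])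
        (auto intro!: continuous_intros)
    show "continuous_on ({0..d} \<times> cbox a b) (\<lambda>(h, x). D F (x + h *\<^sub>R k) k)"
      unfolding split_beta by (rule continuous_on_compose2[OF cD]) (auto intro!: continuous_intros)
  qed (use d in auto)
  moreover have "integral (cbox a b) (\<lambda>x. F (x + h *\<^sub>R k)) = integral (cbox a b) F" if "h \<in> {0..d}" for h
    using that d by (intro integral_translation_periodic_box C1_continuous F k per) auto
  ultimately have "((\<lambda>h. integral (cbox a b) F) has_vector_derivative 
      integral (cbox a b) (\<lambda>x. D F x k)) (at 0 within {0..d})"
    using has_vector_derivative_transform[of 0 "{0..d}" "\<lambda>h. integral (cbox a b) F" "\<lambda>h. integral (cbox a b) (\<lambda>x. F (x + h *\<^sub>R k))"] d
    by simp
  moreover have "((\<lambda>h. integral (cbox a b) F) has_vector_derivative 0) (at 0 within {0..d})" by simp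
  ultimately show ?thesis
    using d(1) by (intro vector_derivative_unique_within_closed_interval[of 0 d 0 "\<lambda>h. integral (cbox a b) F"])
      (auto simp only: box_real atLeastAtMost_iff order_refl less_imp_le)
qed

text \<open>A lattice basis is indexed by \<open>'n\<close>, so that \<open>A\<close> carries the unit cube to a fundamental cell.\<close>

lemma lattice_linear:
  assumes "lattice (L :: (real ^ 'n::finite) set)"
  obtains A :: "real ^ 'n \<Rightarrow> real ^ 'n" where "linear A" "surj A"
    "\<forall>s. (\<forall>i. s $ i \<in> \<int>) \<longrightarrow> A s \<in> L"
proof -
  obtain B where B: "independent B" "span B = UNIV"
    "L = {\<Sum>b\<in>B. of_int (c b) *\<^sub>R b |c. (c :: real ^ 'n \<Rightarrow> int) \<in> UNIV}"
    using assms unfolding lattice_def by blast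
  have fB: "finite B" using B(1) independent_imp_finite by blast
  have "card B = CARD('n)"
    using basis_card_eq_dim[of B UNIV] B by (simp add: dim_UNIV)
  then obtain f :: "'n \<Rightarrow> real ^ 'n" where f: "bij_betw f UNIV B"
    using finite_same_card_bij[of "UNIV :: 'n set" B] fB by auto
  define A where "A s = (\<Sum>i\<in>UNIV. (s $ i) *\<^sub>R f i)" for s :: "real ^ 'n"
  have lin: "linear A"
    by (rule linearI) (auto simp: A_def algebra_simps sum.distrib scaleR_sum_right)
  have "surj A"
  proof -
    have "B \<subseteq> range A"
    proof
      fix b assume "b \<in> B"
      then obtain i where "b = f i" using f by (auto simp: bij_betw_def)
      then have "A (axis i 1) = b"
        unfolding A_def by (simp add: axis_def if_distrib if_distribR sum.delta cong: if_cong)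
      then show "b \<in> range A" by blast
    qed
    then have "span B \<subseteq> range A"
      by (rule span_minimal) (simp add: lin linear_subspace_image subspace_UNIV)
    then show ?thesis using B by auto
  qed
  moreover have "A s \<in> L" if s: "\<forall>i. s $ i \<in> \<int>" for s
  proof -
    have "A s = (\<Sum>i\<in>UNIV. (s $ inv f (f i)) *\<^sub>R f i)"
      using f by (simp add: A_def bij_betw_def)
    also have "\<dots> = (\<Sum>b\<in>B. (s $ inv f b) *\<^sub>R b)"
      by (rule sum.reindex_bij_betw[OF f, of "\<lambda>b. (s $ inv f b) *\<^sub>R b"])
    also have "\<dots> = (\<Sum>b\<in>B. of_int \<lfloor>s $ inv f b\<rfloor> *\<^sub>R b)"
      using s by (intro sum.cong) (auto simp: of_int_floor)
    finally show ?thesis unfolding B(3) by (auto intro!: exI[of _ "\<lambda>b. \<lfloor>s $ inv f b\<rfloor>"])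
  qed
  ultimately show thesis using that[of A] lin by blast
qed

section \<open>The magnetic flow of a conformally flat metric\<close>

lemma linear_D: "C1 f \<Longrightarrow> linear (D f x)"
  by (rule bounded_linear.linear[OF C1_bounded_linear_D])

lemma has_derivative_comp_fst:
  "C1 f \<Longrightarrow> ((\<lambda>x. f (fst x)) has_derivative (\<lambda>w. D f (fst x) (fst w))) (at x)"
  by (rule has_derivative_compose[OF has_derivative_fst[OF has_derivative_ident] C1_has_derivative])

lemma has_vector_derivative_comp_C1:
  assumes "C1 f" "(c has_vector_derivative c') (at t within S)"
  shows "((\<lambda>t. f (c t)) has_vector_derivative D f (c t) c') (at t within S)"
proof -
  have "((\<lambda>t. f (c t)) has_derivative (\<lambda>s. D f (c t) (s *\<^sub>R c'))) (at t within S)"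
    using has_derivative_compose[OF _ C1_has_derivative[OF assms(1)]] assms(2)
    by (simp add: has_vector_derivative_def)
  also have "(\<lambda>s. D f (c t) (s *\<^sub>R c')) = (\<lambda>s. s *\<^sub>R D f (c t) c')"
    using bounded_linear.linear[OF C1_bounded_linear_D[OF assms(1)]] linear_scale by blast
  finally show ?thesis by (simp add: has_vector_derivative_def)
qed

lemma has_zero_derivative_const:
  fixes f :: "real \<Rightarrow> 'z::real_normed_vector"
  assumes "\<And>t. (f has_vector_derivative 0) (at t)" shows "f t = f 0"
proof -
  have "(f has_derivative (\<lambda>_. 0)) (at t)" for t using assms by (simp add: has_vector_derivative_def)
  then show ?thesis using has_derivative_zero_unique[of UNIV f 0 t] by simp
qed

section \<open>The Hamiltonian vector field in linear coordinates\<close>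

definition grad :: "(real ^ 'n::finite \<Rightarrow> real) \<Rightarrow> real ^ 'n \<Rightarrow> real ^ 'n" where
  "grad f q = (\<chi> i. D f q (axis i 1))"

definition form_matrix :: "'n::finite tensor2 \<Rightarrow> real ^ 'n \<Rightarrow> real ^ 'n ^ 'n" where
  "form_matrix \<beta> q = (\<chi> i j. \<beta> q (axis i 1) (axis j 1))"

text \<open>Hamilton's equations of the twisted form: the summand with \<open>form_matrix\<close> is
  the magnetic force, the one with \<open>grad\<close> the geodesic force of the conformal
  metric.\<close>

definition magnetic_vf :: "(real ^ 'n::finite \<Rightarrow> real) \<Rightarrow> 'n tensor2 \<Rightarrow> 'n phase \<Rightarrow> 'n phase" where
  "magnetic_vf lam \<beta> x =
     (lam (fst x) *\<^sub>R snd x,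
      lam (fst x) *\<^sub>R (form_matrix \<beta> (fst x) *v snd x) - ((snd x \<bullet> snd x) / 2) *\<^sub>R grad lam (fst x))"

lemma grad_inner: "C1 f \<Longrightarrow> grad f q \<bullet> v = D f q v" for f :: "real ^ 'n::finite \<Rightarrow> real"
proof -
  assume f: "C1 f"
  interpret bounded_linear "D f q" by (rule C1_bounded_linear_D[OF f])
  have "D f q v = D f q (\<Sum>i\<in>UNIV. (v $ i) *\<^sub>R axis i 1)"
    using basis_expansion[of v] by (simp add: scalar_mult_eq_scaleR)
  also have "\<dots> = (\<Sum>i\<in>UNIV. v $ i * D f q (axis i 1))"
    by (simp add: sum scaleR)
  finally show ?thesis by (simp add: grad_def inner_vec_def mult.commute)
qed

lemma D_periodic:
  assumes "C1 f" "\<And>x. f (x + l) = f x" shows "D f (x + l) = D f x"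
proof -
  have "((\<lambda>x. f (x + l)) has_derivative D f (x + l)) (at x)"
    using has_derivative_compose[OF has_derivative_add[OF has_derivative_ident has_derivative_const]
        C1_has_derivative[OF assms(1)]] by simp
  from D_eq[OF this] show ?thesis by (simp add: assms(2))
qed

lemma form_matrix_inner:
  assumes "bilinear (\<beta> q)" shows "u \<bullet> (form_matrix \<beta> q *v v) = \<beta> q u v"
proof -
  have "\<beta> q u v = \<beta> q (\<Sum>i\<in>UNIV. (u $ i) *\<^sub>R axis i 1) (\<Sum>j\<in>UNIV. (v $ j) *\<^sub>R axis j 1)"
    using basis_expansion[of u] basis_expansion[of v] by (simp add: scalar_mult_eq_scaleR)
  also have "\<dots> = (\<Sum>(i, j)\<in>UNIV \<times> UNIV. \<beta> q ((u $ i) *\<^sub>R axis i 1) ((v $ j) *\<^sub>R axis j 1))"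
    by (rule bilinear_sum[OF assms])
  also have "\<dots> = (\<Sum>i\<in>UNIV. \<Sum>j\<in>UNIV. v $ j * (u $ i * \<beta> q (axis i 1) (axis j 1)))"
    by (simp add: bilinear_lmul[OF assms] bilinear_rmul[OF assms] sum.cartesian_product)
  finally show ?thesis
    by (simp add: form_matrix_def inner_vec_def matrix_vector_mult_def sum_distrib_left mult_ac)
qed

lemma D_fst: "D fst x = (fst :: 'a::real_normed_vector \<times> 'b::real_normed_vector \<Rightarrow> 'a)"
  by (rule D_eq) (rule has_derivative_fst[OF has_derivative_ident])

lemma D_proj: "D proj x = fst" for x :: "'n::finite phase"
proof -
  have "(proj :: 'n phase \<Rightarrow> _) = fst" by (rule ext) (simp add: proj_def)
  then show ?thesis by (simp add: D_fst)
qed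

lemma kinetic_energy_conformal:
  assumes "lam (fst x) > 0" "\<And>u v. g (fst x) u v = (1 / lam (fst x)) * (u \<bullet> v)"
  shows "kinetic_energy g x = lam (fst x) * (snd x \<bullet> snd x) / 2"
proof -
  have "sharp g (fst x) p = lam (fst x) *\<^sub>R p" for p
    unfolding sharp_def
  proof (rule the_equality)
    show "\<forall>v. g (fst x) (lam (fst x) *\<^sub>R p) v = p \<bullet> v" using assms by simp
    fix u assume "\<forall>v. g (fst x) u v = p \<bullet> v"
    then have "u \<bullet> v = (lam (fst x) *\<^sub>R p) \<bullet> v" for v
      using assms by (simp add: field_simps)
    then show "u = lam (fst x) *\<^sub>R p" using vector_eq_rdot by blast
  qed
  then show ?thesis using assms by (simp add: kinetic_energy_def cometric_def)
qed

text \<open>The twisted form is nondegenerate: pairing with vertical vectors determines the position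
  component, and pairing with horizontal vectors then determines the momentum component. This
  settles the description by \<open>THE\<close>.\<close>

lemma hamiltonian_vf_conformal:
  fixes \<beta> :: "'n::finite tensor2"
  assumes lam: "C1 lam" "\<And>q. lam q > 0" and g: "\<And>q u v. g q u v = (1 / lam q) * (u \<bullet> v)"
    and b: "\<And>q. bilinear (\<beta> q)"
  shows "hamiltonian_vf (twisted_form \<beta>) (kinetic_energy g) = magnetic_vf lam \<beta>"
proof
  fix x :: "'n phase"
  obtain q p where x: "x = (q, p)" by (cases x)
  have H: "kinetic_energy g = (\<lambda>x. lam (fst x) * (snd x \<bullet> snd x) / 2)"
    using kinetic_energy_conformal lam g by (metis (no_types, lifting) ext)
  have "((\<lambda>x. lam (fst x) * (snd x \<bullet> snd x) / 2) has_derivative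
      (\<lambda>w. (lam q * (p \<bullet> snd w + snd w \<bullet> p) + D lam q (fst w) * (p \<bullet> p)) / 2)) (at x)"
    unfolding x
    by (auto intro!: derivative_eq_intros has_derivative_compose[of fst _ _ _ lam]
        C1_has_derivative[OF lam(1)] simp: )
  from D_eq[OF this] have DH: "D (kinetic_energy g) x w = lam q * (p \<bullet> snd w) + (grad lam q \<bullet> fst w) * (p \<bullet> p) / 2" for w
    unfolding H by (simp add: grad_inner[OF lam(1), symmetric] inner_commute[of "snd w" p] add_divide_distrib)
  have tw: "twisted_form \<beta> x w \<xi> = snd w \<bullet> fst \<xi> - fst w \<bullet> snd \<xi> + fst w \<bullet> (form_matrix \<beta> q *v fst \<xi>)" for w \<xi>
    unfolding twisted_form_def omega0_def pullback_proj_def D_proj form_matrix_inner[OF b]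
    by (simp add: x proj_def inner_vec_def sum_subtractf)
  show "hamiltonian_vf (twisted_form \<beta>) (kinetic_energy g) x = magnetic_vf lam \<beta> x"
    unfolding hamiltonian_vf_def
  proof (rule the_equality)
    show "\<forall>w. twisted_form \<beta> x w (magnetic_vf lam \<beta> x) = D (kinetic_energy g) x w"
      unfolding tw DH
      by (simp add: magnetic_vf_def x inner_diff_right matrix_vector_mult_scaleR inner_commute algebra_simps)
    fix \<xi> assume *: "\<forall>w. twisted_form \<beta> x w \<xi> = D (kinetic_energy g) x w"
    have "v \<bullet> fst \<xi> = v \<bullet> (lam q *\<^sub>R p)" for v
      using *[rule_format, of "(0, v)"] unfolding tw DH by (simp add: inner_commute)
    then have 1: "fst \<xi> = lam q *\<^sub>R p" using vector_eq_ldot by blast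
    have "v \<bullet> snd \<xi> = v \<bullet> (lam q *\<^sub>R (form_matrix \<beta> q *v p) - (p \<bullet> p / 2) *\<^sub>R grad lam q)" for v
      using *[rule_format, of "(v, 0)"] unfolding tw DH 1
      by (simp add: inner_commute inner_diff_left inner_diff_right matrix_vector_mult_scaleR algebra_simps)
    then have "snd \<xi> = lam q *\<^sub>R (form_matrix \<beta> q *v p) - (p \<bullet> p / 2) *\<^sub>R grad lam q"
      using vector_eq_ldot by blast
    with 1 show "\<xi> = magnetic_vf lam \<beta> x" by (simp add: magnetic_vf_def x prod_eq_iff)
  qed
qed

lemma smooth_grad: "smooth f \<Longrightarrow> C1 (grad f)"
  unfolding grad_def by (intro C1_intros smooth_C1 smooth_D)

locale conformal_magnetic =
  fixes L :: "(real ^ 'n::finite) set" and lam :: "real ^ 'n \<Rightarrow> real" and \<beta> :: "'n tensor2"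
    and \<Phi> :: "real \<Rightarrow> 'n phase \<Rightarrow> 'n phase"
  assumes L: "lattice L"
    and lam_smooth: "smooth lam" and lam_periodic: "periodic L lam" and lam_pos: "lam q > 0"
    and form: "two_form L \<beta>" and closed: "closed_form \<beta>"
    and flow: "is_flow (magnetic_vf lam \<beta>) \<Phi>"
begin

abbreviation "X \<equiv> magnetic_vf lam \<beta>"
abbreviation "B \<equiv> form_matrix \<beta>"
abbreviation "G \<equiv> grad lam"
abbreviation "\<Psi> \<equiv> (\<lambda>(t, x). \<Phi> t x)"

text \<open>Twice the Hamiltonian, so the level of the theorem is \<open>en x = 1\<close>.\<close>

definition en :: "'n phase \<Rightarrow> real" where "en x = lam (fst x) * (snd x \<bullet> snd x)"

lemma lam_nonzero [simp]: "lam q \<noteq> 0" using lam_pos[of q] by simp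

lemma C1_lam: "C1 lam" by (rule smooth_C1[OF lam_smooth])
lemma C1_G: "C1 G" by (rule smooth_grad[OF lam_smooth])
lemma bil: "bilinear (\<beta> q)" using form by (auto simp: two_form_def smooth_tensor2_def)

lemma C1_B: "C1 B"
  unfolding form_matrix_def
  by (intro C1_intros smooth_C1) (use form in \<open>auto simp: two_form_def smooth_tensor2_def\<close>)

lemmas C1_comp_intros = C1_intros C1_compose[OF C1_lam] C1_compose[OF C1_G] C1_compose[OF C1_B]

lemma C1_X: "C1 X"
proof -
  have X: "X = (\<lambda>x. (lam (fst x) *\<^sub>R snd x,
      lam (fst x) *\<^sub>R (B (fst x) *v snd x) - ((snd x \<bullet> snd x) * (1 / 2)) *\<^sub>R G (fst x)))"
    by (rule ext) (simp add: magnetic_vf_def)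
  show ?thesis unfolding X by (intro C1_comp_intros)
qed

lemma D_X:
  "D X (q, p) (\<zeta>, \<pi>) = ((G q \<bullet> \<zeta>) *\<^sub>R p + lam q *\<^sub>R \<pi>,
     (G q \<bullet> \<zeta>) *\<^sub>R (B q *v p) + lam q *\<^sub>R (D B q \<zeta> *v p) + lam q *\<^sub>R (B q *v \<pi>)
       - (p \<bullet> \<pi>) *\<^sub>R G q - (p \<bullet> p / 2) *\<^sub>R D G q \<zeta>)"
proof -
  have X: "X = (\<lambda>x. (lam (fst x) *\<^sub>R snd x,
      lam (fst x) *\<^sub>R (B (fst x) *v snd x) - ((snd x \<bullet> snd x) / 2) *\<^sub>R G (fst x)))"
    by (rule ext) (simp add: magnetic_vf_def)
  have "(X has_derivative (\<lambda>w. (lam q *\<^sub>R snd w + D lam q (fst w) *\<^sub>R p,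
      (lam q *\<^sub>R (B q *v snd w + D B q (fst w) *v p) + D lam q (fst w) *\<^sub>R (B q *v p))
       - ((p \<bullet> p / 2) *\<^sub>R D G q (fst w) + ((p \<bullet> snd w + snd w \<bullet> p) / 2) *\<^sub>R G q)))) (at (q, p))"
    unfolding X
    by (auto intro!: derivative_eq_intros has_derivative_comp_fst[of _ "(q, p)", simplified] 
       bounded_bilinear.FDERIV[OF bounded_bilinear_matrix_vector_mult, of "\<lambda>x. B (fst x)" _ "(q, p)" _ snd, simplified]
       C1_lam C1_G C1_B simp: inner_commute field_simps)
  from D_eq[OF this] show ?thesis
    by (auto simp: grad_inner[OF C1_lam, symmetric] inner_commute[of \<pi> p] algebra_simps)
qed

lemma B_skew: "u \<bullet> (B q *v v) = - (v \<bullet> (B q *v u))"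
proof -
  have "\<beta> q (u + v) (u + v) = 0" "\<beta> q u u = 0" "\<beta> q v v = 0"
    using form by (auto simp: two_form_def)
  then show ?thesis
    by (simp add: form_matrix_inner[OF bil] bilinear_ladd[OF bil] bilinear_radd[OF bil])
qed

lemma B_inner_self [simp]: "u \<bullet> (B q *v u) = 0"
  using B_skew[of u q u] by simp

lemma D_form: "D (\<lambda>q. \<beta> q u v) q w = u \<bullet> (D B q w *v v)"
proof -
  have "((\<lambda>q. u \<bullet> (B q *v v)) has_derivative (\<lambda>w. u \<bullet> (D B q w *v v))) (at q)"
    by (intro has_derivative_inner_right bounded_linear.has_derivative[OF 
       bounded_bilinear.bounded_linear_left[OF bounded_bilinear_matrix_vector_mult]] C1_has_derivative C1_B)
  from D_eq[OF this] show ?thesis by (simp add: form_matrix_inner[OF bil] fun_eq_iff)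
qed

lemma DB_skew: "u \<bullet> (D B q w *v v) = - (v \<bullet> (D B q w *v u))"
proof -
  have "((\<lambda>q. u \<bullet> (B q *v v)) has_derivative (\<lambda>w. u \<bullet> (D B q w *v v))) (at q)" for u v
    by (intro has_derivative_inner_right bounded_linear.has_derivative[OF 
       bounded_bilinear.bounded_linear_left[OF bounded_bilinear_matrix_vector_mult]] C1_has_derivative C1_B)
  from has_derivative_minus[OF this[of v u]] this[of u v]
  have "(\<lambda>w. - (v \<bullet> (D B q w *v u))) = (\<lambda>w. u \<bullet> (D B q w *v v))"
    unfolding B_skew[of v _ u] by (intro has_derivative_unique) simp_all
  from fun_cong[OF this, of w] show ?thesis by simp
qed

lemma B_closed: "u \<bullet> (D B q w *v v) - w \<bullet> (D B q u *v v) + w \<bullet> (D B q v *v u) = 0"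
proof -
  have "ext_deriv \<beta> q w u v = 0" using closed by (simp add: closed_form_def)
  then show ?thesis unfolding ext_deriv_def D_form by simp
qed

lemma D_D_lam: "D (\<lambda>q. D lam q v) q u = D G q u \<bullet> v"
proof -
  have "((\<lambda>q. G q \<bullet> v) has_derivative (\<lambda>w. D G q w \<bullet> v)) (at q)"
    by (intro has_derivative_inner_left C1_has_derivative C1_G)
  from D_eq[OF this] show ?thesis by (simp add: grad_inner[OF C1_lam])
qed

lemma hess_symmetric: "D G q u \<bullet> v = D G q v \<bullet> u"
  using second_derivative_symmetric[OF C1_lam smooth_C1[OF smooth_D[OF lam_smooth]], of v q u]
  by (simp add: D_D_lam)

section \<open>Derivatives of the flow and its equivariance under the lattice\<close>

lemma smooth_\<Psi>: "smooth \<Psi>" and flow_0 [simp]: "\<Phi> 0 x = x"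
  and flow_add: "\<Phi> (s + t) x = \<Phi> s (\<Phi> t x)"
  and flow_deriv: "((\<lambda>s. \<Phi> s x) has_vector_derivative X (\<Phi> t x)) (at t)"
  using flow unfolding is_flow_def by blast+

lemma C1_\<Psi>: "C1 \<Psi>" by (rule smooth_C1[OF smooth_\<Psi>])

lemma C1_flow_comp: "C1 f \<Longrightarrow> C1 g \<Longrightarrow> C1 (\<lambda>x. \<Phi> (f x) (g x))"
  using C1_compose[OF C1_\<Psi> C1_Pair, of f g] by simp

lemma C1_flow: "C1 (\<Phi> t)"
  using C1_flow_comp[OF C1_const[of t] C1_ident] .

lemma D_flow_time: "D \<Psi> (t, x) (1, 0) = X (\<Phi> t x)"
proof -
  have "((\<lambda>s. \<Psi> ((0, x) + s *\<^sub>R (1, 0))) has_vector_derivative D \<Psi> ((0, x) + t *\<^sub>R (1, 0)) (1, 0)) (at t)"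
    by (rule C1_line[OF C1_\<Psi>])
  then have "((\<lambda>s. \<Phi> s x) has_vector_derivative D \<Psi> (t, x) (1, 0)) (at t)" by simp
  then show ?thesis using flow_deriv vector_derivative_unique_at by blast
qed

lemma D_flow_space: "D \<Psi> (t, x) (0, w) = D (\<Phi> t) x w"
proof -
  have "((\<lambda>x. (t, x)) has_derivative (\<lambda>w. (0, w))) (at x)"
    by (auto intro!: derivative_eq_intros)
  from has_derivative_compose[OF this C1_has_derivative[OF C1_\<Psi>]]
  have "(\<Phi> t has_derivative (\<lambda>w. D \<Psi> (t, x) (0, w))) (at x)" by simp
  from D_eq[OF this] show ?thesis by simp
qed

lemma D_\<Psi>: "D \<Psi> (t, x) (s, w) = s *\<^sub>R X (\<Phi> t x) + D (\<Phi> t) x w"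
proof -
  interpret bounded_linear "D \<Psi> (t, x)" by (rule C1_bounded_linear_D[OF C1_\<Psi>])
  have "(s, w) = s *\<^sub>R (1, 0) + (0, w)" by simp
  then have "D \<Psi> (t, x) (s, w) = s *\<^sub>R D \<Psi> (t, x) (1, 0) + D \<Psi> (t, x) (0, w)"
    by (simp only: add scaleR)
  then show ?thesis by (simp add: D_flow_time D_flow_space)
qed

text \<open>Differentiate both expressions for \<open>\<Phi> (t + s) x\<close> at
  \<open>s = 0\<close>: once through the group law, once along the orbit.\<close>

lemma D_flow_X: "D (\<Phi> t) x (X x) = X (\<Phi> t x)"
proof -
  have "((\<lambda>s. \<Phi> s x) has_derivative (\<lambda>s. s *\<^sub>R X (\<Phi> 0 x))) (at 0)"
    using flow_deriv[of x 0] unfolding has_vector_derivative_def .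
  from has_derivative_compose[OF this, of "\<Phi> t"]
  have "((\<lambda>s. \<Phi> t (\<Phi> s x)) has_derivative (\<lambda>s. D (\<Phi> t) x (s *\<^sub>R X x))) (at 0)"
    using C1_has_derivative[OF C1_flow] by simp
  also have "(\<lambda>s. D (\<Phi> t) x (s *\<^sub>R X x)) = (\<lambda>s. s *\<^sub>R D (\<Phi> t) x (X x))"
    using bounded_linear.linear[OF C1_bounded_linear_D[OF C1_flow]] linear_scale by blast
  finally have 1: "((\<lambda>s. \<Phi> (t + s) x) has_vector_derivative D (\<Phi> t) x (X x)) (at 0)"
    by (simp add: flow_add has_vector_derivative_def)
  have "((\<lambda>s. \<Phi> (t + s) x) has_vector_derivative X (\<Phi> (t + 0) x)) (at 0)"
    using vector_diff_chain_at[of "\<lambda>s. t + s" 1 0 "\<lambda>s. \<Phi> s x" "X (\<Phi> (t + 0) x)"] flow_deriv[of x "t + 0"]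
      has_vector_derivative_add[OF has_vector_derivative_const[of t] has_vector_derivative_id[of "at 0"]]
    by (simp add: o_def)
  with 1 show ?thesis using vector_derivative_unique_at by fastforce
qed

lemma flow_deriv_comp:
  assumes "(c has_vector_derivative c') (at t)" "(f has_real_derivative f') (at t)"
  shows "((\<lambda>t. \<Phi> (f t) (c t)) has_vector_derivative (f' *\<^sub>R X (\<Phi> (f t) (c t)) + D (\<Phi> (f t)) (c t) c')) (at t)"
proof -
  have "((\<lambda>t. (f t, c t)) has_derivative (\<lambda>s. (s * f', s *\<^sub>R c'))) (at t)"
    using assms by (intro has_derivative_Pair) (simp_all add: has_vector_derivative_def has_real_derivative_iff_has_vector_derivative)
  from has_derivative_compose[OF this C1_has_derivative[OF C1_\<Psi>]]
  have "((\<lambda>t. \<Phi> (f t) (c t)) has_derivative (\<lambda>s. D \<Psi> (f t, c t) (s *\<^sub>R (f', c')))) (at t)" by simp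
  also have "(\<lambda>s. D \<Psi> (f t, c t) (s *\<^sub>R (f', c'))) = (\<lambda>s. s *\<^sub>R D \<Psi> (f t, c t) (f', c'))"
    using bounded_linear.linear[OF C1_bounded_linear_D[OF C1_\<Psi>]] linear_scale by blast
  finally show ?thesis by (simp add: has_vector_derivative_def D_\<Psi>)
qed

text \<open>Pulled back by the flow, the curve \<open>\<Phi> (- t) (c t)\<close> has zero derivative
  by \<open>D_flow_X\<close>, so uniqueness follows from the group law. It serves to show that the
  flow commutes with lattice translations.\<close>

lemma flow_unique:
  assumes "\<And>t. (c has_vector_derivative X (c t)) (at t)" shows "c t = \<Phi> t (c 0)"
proof -
  have "((\<lambda>t. \<Phi> (- t) (c t)) has_vector_derivative 0) (at t)" for t
    using flow_deriv_comp[OF assms DERIV_minus[OF DERIV_ident], of t] by (simp add: D_flow_X)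
  then have "((\<lambda>t. \<Phi> (- t) (c t)) has_derivative (\<lambda>_. 0)) (at t)" for t
    by (simp add: has_vector_derivative_def)
  then have "\<Phi> (- t) (c t) = \<Phi> (- 0) (c 0)"
    using has_derivative_zero_unique[of UNIV "\<lambda>t. \<Phi> (- t) (c t)"] by (metis UNIV_I convex_UNIV)
  then have "\<Phi> t (\<Phi> (- t) (c t)) = \<Phi> t (c 0)" by simp
  then show ?thesis using flow_add[of t "- t" "c t"] by simp
qed

lemma lam_add [simp]: "l \<in> L \<Longrightarrow> lam (q + l) = lam q"
  using lam_periodic by (simp add: periodic_def)

lemma B_periodic: "l \<in> L \<Longrightarrow> B (q + l) = B q"
  using form by (simp add: form_matrix_def two_form_def smooth_tensor2_def periodic_def)

lemma G_periodic: "l \<in> L \<Longrightarrow> G (q + l) = G q"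
  by (simp add: grad_def D_periodic[OF C1_lam])

lemma X_periodic: "l \<in> L \<Longrightarrow> X (x + (l, 0)) = X x"
  by (simp add: magnetic_vf_def B_periodic G_periodic)

lemma flow_periodic:
  assumes "l \<in> L" shows "\<Phi> t (x + (l, 0)) = \<Phi> t x + (l, 0)"
proof -
  have "((\<lambda>t. \<Phi> t x + (l, 0)) has_vector_derivative X (\<Phi> t x + (l, 0))) (at t)" for t
    using has_vector_derivative_add[OF flow_deriv[of x t] has_vector_derivative_const[of "(l, 0)"]]
    by (simp add: X_periodic[OF assms])
  from flow_unique[OF this] show ?thesis by simp
qed

section \<open>Conservation of the energy and of the twisted form\<close>

lemma C1_en: "C1 en"
  unfolding en_def by (intro C1_comp_intros)

lemma D_en: "D en (q, p) (\<zeta>, \<pi>) = 2 * lam q * (p \<bullet> \<pi>) + (G q \<bullet> \<zeta>) * (p \<bullet> p)"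
proof -
  have "(en has_derivative (\<lambda>w. lam q * (p \<bullet> snd w + snd w \<bullet> p) + D lam q (fst w) * (p \<bullet> p))) (at (q, p))"
    unfolding en_def
    by (auto intro!: derivative_eq_intros has_derivative_comp_fst[of _ "(q, p)", simplified] C1_lam)
  from D_eq[OF this] show ?thesis by (simp add: grad_inner[OF C1_lam, symmetric] inner_commute[of \<pi> p])
qed

lemma D_en_X: "D en x (X x) = 0"
  by (cases x) (simp add: magnetic_vf_def D_en inner_diff_right inner_commute)

lemma en_flow: "en (\<Phi> t x) = en x"
  using has_zero_derivative_const[of "\<lambda>t. en (\<Phi> t x)" t]
    has_vector_derivative_comp_C1[OF C1_en flow_deriv] by (simp add: D_en_X)

text \<open>The variational equation: the time and space derivatives of the joint map
  \<open>\<Psi>\<close> commute, and its time derivative is \<open>X\<close>.\<close>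

lemma linearized_flow:
  "((\<lambda>t. D (\<Phi> t) x w) has_vector_derivative D X (\<Phi> t x) (D (\<Phi> t) x w)) (at t)"
proof -
  have "((\<lambda>s. D \<Psi> ((0, x) + s *\<^sub>R (1, 0)) (0, w)) has_vector_derivative 
      D (\<lambda>y. D \<Psi> y (0, w)) ((0, x) + t *\<^sub>R (1, 0)) (1, 0)) (at t)"
    by (rule C1_line[OF smooth_C1[OF smooth_D[OF smooth_\<Psi>]]])
  then have 1: "((\<lambda>s. D (\<Phi> s) x w) has_vector_derivative D (\<lambda>y. D \<Psi> y (0, w)) (t, x) (1, 0)) (at t)"
    by (simp add: D_flow_space)
  have "D (\<lambda>y. D \<Psi> y (0, w)) (t, x) (1, 0) = D (\<lambda>y. D \<Psi> y (1, 0)) (t, x) (0, w)"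
    by (rule second_derivative_symmetric[OF C1_\<Psi> smooth_C1[OF smooth_D[OF smooth_\<Psi>]]])
  also have "(\<lambda>y. D \<Psi> y (1, 0)) = (\<lambda>y. X (\<Psi> y))"
    using D_flow_time by (auto simp: fun_eq_iff)
  also have "D (\<lambda>y. X (\<Psi> y)) (t, x) (0, w) = D X (\<Phi> t x) (D (\<Phi> t) x w)"
    using D_eq[OF has_derivative_compose[OF C1_has_derivative[OF C1_\<Psi>] C1_has_derivative[OF C1_X]], of "(t, x)"]
    by (simp add: D_flow_space)
  finally show ?thesis using 1 by simp
qed

text \<open>The vertical space is Lagrangian for the twisted form and the flow preserves that form.
  Invariance is checked by differentiating in time: the Hessian terms of \<open>lam\<close> cancel
  by symmetry, the derivatives of the form by closedness, the rest by skewness.\<close>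

lemma twisted_form_flow:
  assumes "w1 = (0, v1)" "w2 = (0, v2)"
  shows "snd (D (\<Phi> t) x w1) \<bullet> fst (D (\<Phi> t) x w2) - fst (D (\<Phi> t) x w1) \<bullet> snd (D (\<Phi> t) x w2)
    + fst (D (\<Phi> t) x w1) \<bullet> (B (fst (\<Phi> t x)) *v fst (D (\<Phi> t) x w2)) = 0" (is "?f t = 0")
proof -
  have "(?f has_vector_derivative 0) (at t)" for t
  proof -
    obtain q p where qp: "\<Phi> t x = (q, p)" by fastforce
    obtain z1 p1 where 1: "D (\<Phi> t) x w1 = (z1, p1)" by fastforce
    obtain z2 p2 where 2: "D (\<Phi> t) x w2 = (z2, p2)" by fastforce
    define d1 where "d1 = D X (q, p) (z1, p1)"
    define d2 where "d2 = D X (q, p) (z2, p2)"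
    have c1: "((\<lambda>t. D (\<Phi> t) x w1) has_vector_derivative d1) (at t)"
      and c2: "((\<lambda>t. D (\<Phi> t) x w2) has_vector_derivative d2) (at t)"
      using linearized_flow[of x w1 t] linearized_flow[of x w2 t] by (simp_all add: qp 1 2 d1_def d2_def)
    note c = c1[unfolded has_vector_derivative_def] c2[unfolded has_vector_derivative_def]
    have "((\<lambda>t. B (fst (\<Phi> t x))) has_vector_derivative D B q (lam q *\<^sub>R p)) (at t)"
      using has_vector_derivative_comp_C1[OF C1_compose[OF C1_B C1_fst[OF C1_ident]] flow_deriv, of x t]
        D_eq[OF has_derivative_comp_fst[OF C1_B, of "\<Phi> t x"]] by (simp add: qp magnetic_vf_def)
    note bq = this[unfolded has_vector_derivative_def]
    note m = bounded_bilinear.FDERIV[OF bounded_bilinear_matrix_vector_mult bq has_derivative_fst[OF c(2)]]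
    have "(?f has_derivative (\<lambda>s. s *\<^sub>R (snd d1 \<bullet> z2 + p1 \<bullet> fst d2 - (fst d1 \<bullet> p2 + z1 \<bullet> snd d2)
       + (fst d1 \<bullet> (B q *v z2) + z1 \<bullet> (B q *v fst d2 + D B q (lam q *\<^sub>R p) *v z2))))) (at t)"
      by (rule has_derivative_add[OF has_derivative_diff[OF 
            has_derivative_inner[OF has_derivative_snd[OF c(1)] has_derivative_fst[OF c(2)]]
            has_derivative_inner[OF has_derivative_fst[OF c(1)] has_derivative_snd[OF c(2)]]]
            has_derivative_inner[OF has_derivative_fst[OF c(1)] m], THEN has_derivative_eq_rhs])
        (auto simp: fun_eq_iff qp 1 2 algebra_simps matrix_vector_mult_scaleR scaleR_matrix_vector_assoc[symmetric])
    moreover have "snd d1 \<bullet> z2 + p1 \<bullet> fst d2 - (fst d1 \<bullet> p2 + z1 \<bullet> snd d2)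
       + (fst d1 \<bullet> (B q *v z2) + z1 \<bullet> (B q *v fst d2 + D B q (lam q *\<^sub>R p) *v z2)) = 0"
    proof -
      have DBl: "D B q (lam q *\<^sub>R p) = lam q *\<^sub>R D B q p"
        using bounded_linear.linear[OF C1_bounded_linear_D[OF C1_B]] linear_scale by blast
      have h: "D G q z1 \<bullet> z2 = D G q z2 \<bullet> z1" by (rule hess_symmetric)
      \<comment> \<open>Closedness of the form enters here: it exchanges the derivatives in the
        directions \<open>z1\<close>, \<open>z2\<close> and \<open>p\<close>.\<close>
      have cl: "z2 \<bullet> (D B q z1 *v p) = z1 \<bullet> (D B q z2 *v p) - z1 \<bullet> (D B q p *v z2)"
        using B_closed[of z2 q z1 p] DB_skew[of z1 q p z2] by simp
      have e: "(B q *v p) \<bullet> z2 = - (p \<bullet> (B q *v z2))" "(B q *v p1) \<bullet> z2 = - (p1 \<bullet> (B q *v z2))"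
        "(D B q z1 *v p) \<bullet> z2 = z1 \<bullet> (D B q z2 *v p) - z1 \<bullet> (D B q p *v z2)"
        "p \<bullet> p1 = p1 \<bullet> p" "D G q z1 \<bullet> z2 = z1 \<bullet> D G q z2" "z1 \<bullet> G q = G q \<bullet> z1"
        using B_skew[of z2 q p] B_skew[of z2 q p1] cl h
        by (simp_all only: inner_commute[of "B q *v p" z2] inner_commute[of "B q *v p1" z2]
            inner_commute[of "D B q z1 *v p" z2] inner_commute[of p p1] inner_commute[of z1])
      show ?thesis
        unfolding DBl d1_def d2_def D_X fst_conv snd_conv
        by (simp add: e inner_add_left inner_add_right inner_diff_left inner_diff_right
            matrix_vector_right_distrib matrix_vector_mult_scaleR scaleR_matrix_vector_assoc[symmetric] algebra_simps)
    qed
    ultimately show ?thesis by (simp add: has_vector_derivative_def)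
  qed
  from has_zero_derivative_const[OF this, of t] have "?f t = ?f 0" .
  also have "\<dots> = 0"
  proof -
    have "\<Phi> 0 = (\<lambda>x. x)" by (rule ext) simp
    then have "D (\<Phi> 0) x = (\<lambda>w. w)" using D_eq[OF has_derivative_ident] by simp
    then show ?thesis by (simp add: assms)
  qed
  finally show ?thesis .
qed

end

section \<open>The Riccati equation\<close>

lemma has_vector_derivative_vec:
  fixes f :: "real \<Rightarrow> 'b::euclidean_space ^ 'n::finite"
  assumes "\<And>i. ((\<lambda>t. f t $ i) has_vector_derivative f' $ i) (at t)"
  shows "(f has_vector_derivative f') (at t)"
proof -
  have "((\<lambda>t. \<Sum>i\<in>UNIV. axis i (f t $ i)) has_vector_derivative (\<Sum>i\<in>UNIV. axis i (f' $ i))) (at t)"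
    by (intro has_vector_derivative_sum bounded_linear.has_vector_derivative[OF bounded_linear_axis] assms)
  then show ?thesis by (simp flip: vec_eq_sum_axis)
qed

lemma bounded_bilinear_matrix_matrix_mult:
  "bounded_bilinear ((**) :: real ^ 'n::finite ^ 'm::finite \<Rightarrow> real ^ 'k::finite ^ 'n \<Rightarrow> real ^ 'k ^ 'm)"
proof -
  have "bilinear ((**) :: real ^ 'n::finite ^ 'm::finite \<Rightarrow> real ^ 'k::finite ^ 'n \<Rightarrow> real ^ 'k ^ 'm)"
    unfolding bilinear_def linear_iff
    by (auto simp: matrix_matrix_mult_def vec_eq_iff sum.distrib algebra_simps sum_distrib_left)
  then show ?thesis by (simp add: bilinear_conv_bounded_bilinear)
qed

lemma matrix_apply: "linear f \<Longrightarrow> matrix f *v v = f v" for f :: "real ^ 'n::finite \<Rightarrow> real ^ 'm::finite"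
  using matrix_vector_mul(2) by metis

lemma det_differentiable:
  fixes M :: "real \<Rightarrow> real ^ 'n::finite ^ 'n"
  assumes "\<And>i j. (\<lambda>t. M t $ i $ j) differentiable (at t)"
  shows "(\<lambda>t. det (M t)) differentiable (at t)"
proof -
  have "(\<lambda>t. \<Prod>i\<in>UNIV. M t $ i $ p i) differentiable (at t)" for p
  proof -
    have "((\<lambda>t. M t $ i $ p i) has_derivative frechet_derivative (\<lambda>t. M t $ i $ p i) (at t)) (at t)" for i
      using assms frechet_derivative_works by blast
    from has_derivative_prod[where I=UNIV, OF this] show ?thesis by (rule differentiableI)
  qed
  then show ?thesis unfolding det_def
    by (intro differentiable_sum differentiable_mult differentiable_const) (auto simp: finite_permutations)
qed

lemma matrix_inv_inverse:
  fixes M :: "real ^ 'n::finite ^ 'n"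
  assumes "det M \<noteq> 0" shows "M ** matrix_inv M = mat 1" "matrix_inv M ** M = mat 1"
proof -
  have "\<exists>N. M ** N = mat 1 \<and> N ** M = mat 1"
    using assms by (simp add: invertible_det_nz[symmetric] invertible_def)
  from someI_ex[OF this] show "M ** matrix_inv M = mat 1" "matrix_inv M ** M = mat 1"
    by (simp_all add: matrix_inv_def)
qed

lemma matrix_inv_entry:
  fixes M :: "real ^ 'n::finite ^ 'n"
  assumes "det M \<noteq> 0"
  shows "matrix_inv M $ k $ j = det (\<chi> a b. if b = k then axis j 1 $ a else M $ a $ b) / det M"
proof -
  have "M *v (matrix_inv M *v axis j 1) = axis j 1"
    by (simp add: matrix_vector_mul_assoc matrix_inv_inverse[OF assms])
  then have "matrix_inv M *v axis j 1 = (\<chi> k. det (\<chi> a b. if b = k then axis j 1 $ a else M $ a $ b) / det M)"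
    using cramer[OF assms] by blast
  moreover have "(matrix_inv M *v axis j 1) $ k = matrix_inv M $ k $ j"
    by (simp add: matrix_vector_mult_basis column_def)
  ultimately show ?thesis by simp
qed

text \<open>By Cramer's rule the entries of the inverse are quotients of determinants. Only the
  existence of a derivative is claimed; its value along the Riccati solution is found from a product
  rule instead.\<close>

lemma matrix_inv_differentiable:
  fixes M :: "real \<Rightarrow> real ^ 'n::finite ^ 'n"
  assumes M: "(M has_vector_derivative M') (at t)" and S: "open S" "t \<in> S" and d: "\<And>s. s \<in> S \<Longrightarrow> det (M s) \<noteq> 0"
  shows "\<exists>N. ((\<lambda>s. matrix_inv (M s)) has_vector_derivative N) (at t)"
proof -
  have e: "(\<lambda>s. M s $ a $ b) differentiable (at t)" for a b
    using bounded_linear.has_vector_derivative[OF bounded_linear_vec_nth, OF 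
       bounded_linear.has_vector_derivative[OF bounded_linear_vec_nth, OF M]]
    by (auto intro: differentiableI_vector)
  have "(\<lambda>s. matrix_inv (M s) $ k $ j) differentiable (at t)" for k j
  proof -
    have "(\<lambda>s. det (\<chi> a b. if b = k then axis j 1 $ a else M s $ a $ b) / det (M s)) differentiable (at t)"
    proof (intro differentiable_divide det_differentiable d S e)
      show "(\<lambda>s. (\<chi> a b. if b = k then axis j 1 $ a else M s $ a $ b) $ a $ b) differentiable (at t)" for a b
        by (cases "b = k") (simp_all add: e)
    qed
    then show ?thesis
      unfolding differentiable_def
      using has_derivative_transform_within_open[OF _ S] matrix_inv_entry[OF d, symmetric] by (metis (no_types, lifting))
  qed
  then have *: "((\<lambda>s. matrix_inv (M s) $ k $ j) has_vector_derivative vector_derivative (\<lambda>s. matrix_inv (M s) $ k $ j) (at t)) (at t)" for k j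
    using vector_derivative_works by blast
  show ?thesis
    by (rule exI[of _ "\<chi> k j. vector_derivative (\<lambda>s. matrix_inv (M s) $ k $ j) (at t)"])
       (intro has_vector_derivative_vec, simp add: *)
qed

text \<open>Drop the off-diagonal entries and apply Cauchy-Schwarz to the diagonal. This is the
  passage from the matrix Riccati equation to a scalar inequality for the trace.\<close>

lemma sum_sum_ge_trace_square:
  fixes R :: "'n::finite \<Rightarrow> 'n \<Rightarrow> real"
  shows "(\<Sum>i\<in>UNIV. R i i)\<^sup>2 / real CARD('n) \<le> (\<Sum>i\<in>UNIV. \<Sum>j\<in>UNIV. (R i j)\<^sup>2)"
proof -
  have "(\<Sum>i\<in>UNIV. R i i)\<^sup>2 \<le> real CARD('n) * (\<Sum>i\<in>UNIV. (R i i)\<^sup>2)"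
    using sum_squared_le_sum_of_squares[of "\<lambda>i. R i i" UNIV] by (simp add: mult.commute)
  moreover have "(R i i)\<^sup>2 \<le> (\<Sum>j\<in>UNIV. (R i j)\<^sup>2)" for i
    by (rule member_le_sum) auto
  then have "(\<Sum>i\<in>UNIV. (R i i)\<^sup>2) \<le> (\<Sum>i\<in>UNIV. \<Sum>j\<in>UNIV. (R i j)\<^sup>2)"
    by (rule sum_mono)
  ultimately have "(\<Sum>i\<in>UNIV. R i i)\<^sup>2 \<le> real CARD('n) * (\<Sum>i\<in>UNIV. \<Sum>j\<in>UNIV. (R i j)\<^sup>2)"
    by (meson mult_left_mono of_nat_0_le_iff order_trans)
  then show ?thesis by (simp add: field_simps)
qed

lemma sum_skew_symmetric_product:
  fixes S b :: "'n::finite \<Rightarrow> 'n \<Rightarrow> real"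
  assumes "\<And>i j. S i j = S j i" "\<And>i j. b i j = - b j i"
  shows "(\<Sum>i\<in>UNIV. \<Sum>j\<in>UNIV. b i j * S i j) = 0"
proof -
  have "(\<Sum>i\<in>UNIV. \<Sum>j\<in>UNIV. b i j * S i j) = (\<Sum>j\<in>UNIV. \<Sum>i\<in>UNIV. b i j * S i j)"
    by (rule sum.swap)
  also have "\<dots> = (\<Sum>j\<in>UNIV. \<Sum>i\<in>UNIV. - (b j i * S j i))"
  proof (intro sum.cong refl)
    show "b i j * S i j = - (b j i * S j i)" for i j using assms(1)[of i j] assms(2)[of i j] by simp
  qed
  finally show ?thesis by (simp add: sum_negf)
qed

text \<open>The square is completed with the symmetrised \<open>p \<otimes> v / l\<close>. The cross term of its norm is estimated
  by Cauchy-Schwarz, which is affordable exactly when the dimension is at least two.\<close>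

lemma riccati_trace_inequality:
  fixes A b :: "real ^ 'n::finite ^ 'n" and p v :: "real ^ 'n"
  assumes l: "l > 0" and p: "l * (p \<bullet> p) = 1"
    and skew: "\<And>i j. A $ i $ j - A $ j $ i = b $ i $ j"
  shows "(\<Sum>i\<in>UNIV. \<Sum>j\<in>UNIV. l * b $ i $ j * A $ j $ i - v $ i * p $ j * A $ j $ i 
             - A $ i $ j * p $ j * v $ i - l * A $ i $ j * A $ j $ i)
    \<le> - (l / real CARD('n)) * (trace A + (v \<bullet> p) / l)\<^sup>2 - l / 4 * (\<Sum>i\<in>UNIV. \<Sum>j\<in>UNIV. (b $ i $ j)\<^sup>2) + (v \<bullet> v) / l\<^sup>2"
proof -
  \<comment> \<open>By \<open>skew\<close> the antisymmetric part of \<open>A\<close> is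
    \<open>b / 2\<close>, so \<open>S\<close> is its symmetric part and its pairing with
    \<open>b\<close> vanishes.\<close>
  define S where "S i j = A $ i $ j - b $ i $ j / 2" for i j
  define M where "M i j = (p $ i * v $ j + p $ j * v $ i) / (2 * l)" for i j
  have S: "S i j = S j i" for i j using skew[of i j] skew[of j i] by (simp add: S_def field_simps)
  have b: "b $ i $ j = - b $ j $ i" for i j using skew[of i j] skew[of j i] by simp
  have A: "A $ i $ j = S i j + b $ i $ j / 2" for i j by (simp add: S_def)
  have A': "A $ j $ i = S i j - b $ i $ j / 2" for i j using skew[of i j] A[of i j] by simp
  have M: "M i j = M j i" for i j by (simp add: M_def)
  have pvS: "(\<Sum>i\<in>UNIV. \<Sum>j\<in>UNIV. v $ i * p $ j * S i j) = (\<Sum>i\<in>UNIV. \<Sum>j\<in>UNIV. l * (M i j * S i j))"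
  proof -
    have "(\<Sum>i\<in>UNIV. \<Sum>j\<in>UNIV. v $ i * p $ j * S i j) = (\<Sum>i\<in>UNIV. \<Sum>j\<in>UNIV. v $ j * p $ i * S i j)"
      by (subst sum.swap) (simp add: S)
    moreover have "(\<Sum>i\<in>UNIV. \<Sum>j\<in>UNIV. l * (M i j * S i j)) = 
       (\<Sum>i\<in>UNIV. \<Sum>j\<in>UNIV. v $ i * p $ j * S i j) / 2 + (\<Sum>i\<in>UNIV. \<Sum>j\<in>UNIV. v $ j * p $ i * S i j) / 2"
      unfolding sum_divide_distrib sum.distrib[symmetric]
      using l by (intro sum.cong refl) (simp add: M_def field_simps)
    ultimately show ?thesis by simp
  qed
  have MM: "l * (\<Sum>i\<in>UNIV. \<Sum>j\<in>UNIV. (M i j)\<^sup>2) \<le> (v \<bullet> v) / l\<^sup>2"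
  proof -
    have pp: "p \<bullet> p = 1 / l" using p l by (simp add: field_simps)
    have "(\<Sum>i\<in>UNIV. \<Sum>j\<in>UNIV. (M i j)\<^sup>2) = 
       (\<Sum>i\<in>UNIV. \<Sum>j\<in>UNIV. (p $ i * p $ i) * (v $ j * v $ j) + (v $ i * v $ i) * (p $ j * p $ j)
             + 2 * ((p $ i * v $ i) * (p $ j * v $ j))) / (4 * l\<^sup>2)"
      unfolding sum_divide_distrib by (intro sum.cong refl) (simp add: M_def power2_eq_square field_simps)
    also have "\<dots> = (2 * (p \<bullet> p) * (v \<bullet> v) + 2 * (p \<bullet> v)\<^sup>2) / (4 * l\<^sup>2)"
      by (simp add: sum.distrib sum_distrib_left[symmetric] sum_distrib_right[symmetric] inner_vec_def power2_eq_square)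
    also have "\<dots> \<le> (2 * (p \<bullet> p) * (v \<bullet> v) + 2 * ((p \<bullet> p) * (v \<bullet> v))) / (4 * l\<^sup>2)"
      using Cauchy_Schwarz_ineq[of p v] by (intro divide_right_mono) auto
    also have "\<dots> = (v \<bullet> v) / (l * l\<^sup>2)" by (simp add: pp)
    finally have "l * (\<Sum>i\<in>UNIV. \<Sum>j\<in>UNIV. (M i j)\<^sup>2) \<le> l * ((v \<bullet> v) / (l * l\<^sup>2))"
      using l by (intro mult_left_mono) auto
    then show ?thesis using l by simp
  qed
  have tr: "(\<Sum>i\<in>UNIV. S i i + M i i) = trace A + (v \<bullet> p) / l"
  proof -
    have "b $ i $ i = 0" for i using b[of i i] by simp
    then show ?thesis
      using l by (simp add: S_def M_def trace_def inner_vec_def sum.distrib sum_divide_distrib mult.commute)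
  qed
  \<comment> \<open>The linear term in \<open>b\<close> contributes minus one half of
    \<open>b\<close> squared and the quadratic term in \<open>A\<close> gives back one quarter,
    which leaves the coefficient \<open>- l / 4\<close>.\<close>
  have "(\<Sum>i\<in>UNIV. \<Sum>j\<in>UNIV. l * b $ i $ j * A $ j $ i - v $ i * p $ j * A $ j $ i 
             - A $ i $ j * p $ j * v $ i - l * A $ i $ j * A $ j $ i)
     = (\<Sum>i\<in>UNIV. \<Sum>j\<in>UNIV. l * (b $ i $ j * S i j) - l / 4 * (b $ i $ j)\<^sup>2 
           - 2 * (v $ i * p $ j * S i j) - l * (S i j)\<^sup>2)"
  proof (intro sum.cong refl)
    fix i j
    show "l * b $ i $ j * A $ j $ i - v $ i * p $ j * A $ j $ i - A $ i $ j * p $ j * v $ i - l * A $ i $ j * A $ j $ i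
      = l * (b $ i $ j * S i j) - l / 4 * (b $ i $ j)\<^sup>2 - 2 * (v $ i * p $ j * S i j) - l * (S i j)\<^sup>2"
      unfolding A'[of j i] A[of i j] by (simp add: power2_eq_square field_simps)
  qed
  also have "\<dots> = l * (\<Sum>i\<in>UNIV. \<Sum>j\<in>UNIV. b $ i $ j * S i j) - l / 4 * (\<Sum>i\<in>UNIV. \<Sum>j\<in>UNIV. (b $ i $ j)\<^sup>2)
       - 2 * (\<Sum>i\<in>UNIV. \<Sum>j\<in>UNIV. v $ i * p $ j * S i j) - (\<Sum>i\<in>UNIV. \<Sum>j\<in>UNIV. l * (S i j)\<^sup>2)"
    by (simp add: sum_subtractf sum_distrib_left)
  also have "\<dots> = - l / 4 * (\<Sum>i\<in>UNIV. \<Sum>j\<in>UNIV. (b $ i $ j)\<^sup>2) - l * (\<Sum>i\<in>UNIV. \<Sum>j\<in>UNIV. (S i j + M i j)\<^sup>2)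
       + l * (\<Sum>i\<in>UNIV. \<Sum>j\<in>UNIV. (M i j)\<^sup>2)"
    unfolding pvS sum_skew_symmetric_product[of S "\<lambda>i j. b $ i $ j", OF S b]
    by (simp add: power2_sum sum.distrib sum_distrib_left sum_negf algebra_simps)
  also have "\<dots> \<le> - l / 4 * (\<Sum>i\<in>UNIV. \<Sum>j\<in>UNIV. (b $ i $ j)\<^sup>2) 
       - l * ((trace A + (v \<bullet> p) / l)\<^sup>2 / real CARD('n)) + (v \<bullet> v) / l\<^sup>2"
    using MM mult_left_mono[OF sum_sum_ge_trace_square[of "\<lambda>i j. S i j + M i j"], of l] l unfolding tr by linarith
  finally show ?thesis by simp
qed

context conformal_magnetic
begin

section \<open>The linearized flow on vertical vectors, in matrix form\<close>

definition jac_q :: "'n phase \<Rightarrow> real \<Rightarrow> real ^ 'n ^ 'n" where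
  "jac_q x t = matrix (\<lambda>v. fst (D (\<Phi> t) x (0, v)))"

definition jac_p :: "'n phase \<Rightarrow> real \<Rightarrow> real ^ 'n ^ 'n" where
  "jac_p x t = matrix (\<lambda>v. snd (D (\<Phi> t) x (0, v)))"

lemma linear_D_vertical: "linear (\<lambda>v. D (\<Phi> t) x (0, v))"
  using linear_compose[of "\<lambda>v. (0, v)" "D (\<Phi> t) x"] linear_D[OF C1_flow]
  by (simp add: o_def linear_iff)

lemma jac_q_mult: "jac_q x t *v v = fst (D (\<Phi> t) x (0, v))"
  unfolding jac_q_def using linear_compose[OF linear_D_vertical linear_fst] by (intro matrix_apply) (simp add: o_def)

lemma jac_p_mult: "jac_p x t *v v = snd (D (\<Phi> t) x (0, v))"
  unfolding jac_p_def using linear_compose[OF linear_D_vertical linear_snd] by (intro matrix_apply) (simp add: o_def)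

text \<open>The three \<open>coeff\<close> matrices are blocks of \<open>D X\<close>, with the
  letter of the row first; the remaining block is the scalar \<open>lam\<close>.\<close>

definition coeff_qq :: "'n phase \<Rightarrow> real ^ 'n ^ 'n" where
  "coeff_qq x = (\<chi> i j. snd x $ i * G (fst x) $ j)"

definition coeff_pp :: "'n phase \<Rightarrow> real ^ 'n ^ 'n" where
  "coeff_pp x = (\<chi> i j. lam (fst x) * B (fst x) $ i $ j - G (fst x) $ i * snd x $ j)"

definition coeff_pq :: "'n phase \<Rightarrow> real ^ 'n ^ 'n" where
  "coeff_pq x = matrix (\<lambda>v. (G (fst x) \<bullet> v) *\<^sub>R (B (fst x) *v snd x) + lam (fst x) *\<^sub>R (D B (fst x) v *v snd x)
     - (snd x \<bullet> snd x / 2) *\<^sub>R D G (fst x) v)"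

lemma coeff_qq_mult: "coeff_qq x *v v = (G (fst x) \<bullet> v) *\<^sub>R snd x"
  by (simp add: coeff_qq_def matrix_vector_mult_def vec_eq_iff inner_vec_def sum_distrib_left sum_distrib_right mult_ac)

lemma coeff_pp_mult: "coeff_pp x *v v = lam (fst x) *\<^sub>R (B (fst x) *v v) - (snd x \<bullet> v) *\<^sub>R G (fst x)"
  by (simp add: coeff_pp_def matrix_vector_mult_def vec_eq_iff inner_vec_def sum_distrib_left sum_distrib_right
     sum_subtractf algebra_simps)

lemma coeff_pq_mult: "coeff_pq x *v v = (G (fst x) \<bullet> v) *\<^sub>R (B (fst x) *v snd x) + lam (fst x) *\<^sub>R (D B (fst x) v *v snd x)
     - (snd x \<bullet> snd x / 2) *\<^sub>R D G (fst x) v"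
  unfolding coeff_pq_def
  by (rule matrix_apply, rule linearI)
     (simp_all add: linear_add[OF linear_D[OF C1_B]] linear_add[OF linear_D[OF C1_G]]
      linear_scale[OF linear_D[OF C1_B]] linear_scale[OF linear_D[OF C1_G]] inner_add_right
      matrix_vector_mult_add_rdistrib scaleR_matrix_vector_assoc[symmetric] algebra_simps)

lemma D_X_blocks:
  "D X x w = (coeff_qq x *v fst w + lam (fst x) *\<^sub>R snd w, coeff_pq x *v fst w + coeff_pp x *v snd w)"
  using D_X[of "fst x" "snd x" "fst w" "snd w"] 
  by (simp add: coeff_qq_mult coeff_pp_mult coeff_pq_mult algebra_simps)

lemma jac_deriv:
  shows "(jac_q x has_vector_derivative (coeff_qq (\<Phi> t x) ** jac_q x t + lam (fst (\<Phi> t x)) *\<^sub>R jac_p x t)) (at t)" (is ?q)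
    and "(jac_p x has_vector_derivative (coeff_pq (\<Phi> t x) ** jac_q x t + coeff_pp (\<Phi> t x) ** jac_p x t)) (at t)" (is ?p)
proof -
  have col: "M $ i $ j = (M *v axis j 1) $ i" for M :: "real ^ 'n ^ 'n" and i j
    by (simp add: matrix_vector_mult_basis column_def)
  have q: "jac_q x t $ i $ j = fst (D (\<Phi> t) x (0, axis j 1)) $ i"
    and p: "jac_p x t $ i $ j = snd (D (\<Phi> t) x (0, axis j 1)) $ i" for t i j
    unfolding col[of "jac_q x t"] col[of "jac_p x t"] by (simp_all add: jac_q_mult jac_p_mult)
  show ?q
  proof (intro has_vector_derivative_vec)
    fix i j
    have "((\<lambda>t. fst (D (\<Phi> t) x (0, axis j 1)) $ i) has_vector_derivative 
       fst (D X (\<Phi> t x) (D (\<Phi> t) x (0, axis j 1))) $ i) (at t)"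
      by (intro bounded_linear.has_vector_derivative[OF bounded_linear_vec_nth]
         bounded_linear.has_vector_derivative[OF bounded_linear_fst] linearized_flow)
    then show "((\<lambda>t. jac_q x t $ i $ j) has_vector_derivative 
       (coeff_qq (\<Phi> t x) ** jac_q x t + lam (fst (\<Phi> t x)) *\<^sub>R jac_p x t) $ i $ j) (at t)"
      unfolding col[of "_ + _"] q
      by (simp add: D_X_blocks matrix_vector_mult_add_rdistrib matrix_vector_mul_assoc[symmetric] 
         scaleR_matrix_vector_assoc[symmetric] jac_q_mult jac_p_mult)
  qed
  show ?p
  proof (intro has_vector_derivative_vec)
    fix i j
    have "((\<lambda>t. snd (D (\<Phi> t) x (0, axis j 1)) $ i) has_vector_derivative 
       snd (D X (\<Phi> t x) (D (\<Phi> t) x (0, axis j 1))) $ i) (at t)"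
      by (intro bounded_linear.has_vector_derivative[OF bounded_linear_vec_nth]
         bounded_linear.has_vector_derivative[OF bounded_linear_snd] linearized_flow)
    then show "((\<lambda>t. jac_p x t $ i $ j) has_vector_derivative 
       (coeff_pq (\<Phi> t x) ** jac_q x t + coeff_pp (\<Phi> t x) ** jac_p x t) $ i $ j) (at t)"
      unfolding col[of "_ + _"] p
      by (simp add: D_X_blocks matrix_vector_mult_add_rdistrib matrix_vector_mul_assoc[symmetric] 
         jac_q_mult jac_p_mult)
  qed
qed

text \<open>Only the starting point \<open>x\<close> is examined, not all points of its orbit. A
  failure at \<open>x\<close> already gives conjugate points on the orbit, since \<open>x\<close>
  belongs to it.\<close>

definition no_conj :: "'n phase \<Rightarrow> bool" where
  "no_conj x \<longleftrightarrow> (\<forall>t. t \<noteq> 0 \<longrightarrow> transversal (D (\<Phi> t) x ` vertical x) (vertical (\<Phi> t x)))"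

text \<open>Transversality writes \<open>(u, 0)\<close> as the image of a vertical vector plus a
  vertical vector; the position component shows that \<open>jac_q\<close> is onto.\<close>

lemma jac_q_det:
  assumes "no_conj x" "t \<noteq> 0" shows "det (jac_q x t) \<noteq> 0"
proof -
  have "\<exists>v. jac_q x t *v v = u" for u
  proof -
    have "(u, 0) \<in> {a + w |a w. a \<in> D (\<Phi> t) x ` vertical x \<and> w \<in> vertical (\<Phi> t x)}"
      using assms by (simp add: no_conj_def transversal_def)
    then obtain a w where "(u, 0) = D (\<Phi> t) x a + w" "fst a = 0" "fst w = 0"
      unfolding vertical_def D_proj by blast
    then have "jac_q x t *v snd a = u"
      unfolding jac_q_mult by (metis add.right_neutral fst_add fst_conv prod.collapse)
    then show ?thesis by blast
  qed
  then have "surj ((*v) (jac_q x t))" by (metis surjI)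
  then have "invertible (jac_q x t)"
    by (simp add: invertible_right_inverse matrix_right_invertible_surjective)
  then show ?thesis by (simp add: invertible_det_nz)
qed

section \<open>The transported vertical spaces as graphs\<close>

definition riccati :: "'n phase \<Rightarrow> real \<Rightarrow> real ^ 'n ^ 'n" where
  "riccati x t = jac_p x t ** matrix_inv (jac_q x t)"

text \<open>The restriction to positive times avoids time 0, where \<open>jac_q\<close> is the zero
  matrix. Once a derivative is known to exist, differentiating
  \<open>riccati x s ** jac_q x s = jac_p x s\<close> and multiplying by the inverse on the right
  determines it.\<close>

lemma riccati_deriv:
  assumes nc: "no_conj x" and t: "t > 0"
  shows "(riccati x has_vector_derivative
     (coeff_pp (\<Phi> t x) ** riccati x t + coeff_pq (\<Phi> t x) - riccati x t ** coeff_qq (\<Phi> t x)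
      - lam (fst (\<Phi> t x)) *\<^sub>R (riccati x t ** riccati x t))) (at t)"
proof -
  let ?y = "\<Phi> t x" and ?Z = "jac_q x t" and ?P = "jac_p x t" and ?A = "riccati x t" and ?N = "matrix_inv (jac_q x t)"
  let ?l = "lam (fst ?y)"
  let ?Z' = "coeff_qq ?y ** ?Z + ?l *\<^sub>R ?P" and ?P' = "coeff_pq ?y ** ?Z + coeff_pp ?y ** ?P"
  have d: "s \<in> {0<..} \<Longrightarrow> det (jac_q x s) \<noteq> 0" for s using jac_q_det[OF nc] by simp
  obtain N' where "((\<lambda>s. matrix_inv (jac_q x s)) has_vector_derivative N') (at t)"
    using matrix_inv_differentiable[OF jac_deriv(1), of "{0<..}" t x] d t by auto
  from bounded_bilinear.has_vector_derivative[OF bounded_bilinear_matrix_matrix_mult jac_deriv(2) this]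
  obtain A' where A': "(riccati x has_vector_derivative A') (at t)"
    unfolding riccati_def[abs_def] by blast
  from bounded_bilinear.has_vector_derivative[OF bounded_bilinear_matrix_matrix_mult this jac_deriv(1)]
  have "((\<lambda>s. riccati x s ** jac_q x s) has_vector_derivative (?A ** ?Z' + A' ** ?Z)) (at t)" .
  moreover have "riccati x s ** jac_q x s = jac_p x s" if "s \<in> {0<..}" for s
    using matrix_inv_inverse(2)[OF d[OF that]] by (simp add: riccati_def matrix_mul_assoc[symmetric])
  ultimately have "(jac_p x has_vector_derivative (?A ** ?Z' + A' ** ?Z)) (at t)"
    using has_vector_derivative_transform_within_open[of _ _ t "{0<..}" "jac_p x"] t by simp
  then have "?A ** ?Z' + A' ** ?Z = ?P'"
    using jac_deriv(2) vector_derivative_unique_at by blast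
  then have "A' ** ?Z = ?P' - ?A ** ?Z'" by (simp add: eq_diff_eq add.commute)
  then have "(A' ** ?Z) ** ?N = (?P' - ?A ** ?Z') ** ?N" by simp
  moreover have ZN: "?Z ** ?N = mat 1" using matrix_inv_inverse(1)[OF d] t by simp
  moreover have "M ** ?Z ** ?N = M" for M :: "real ^ 'n ^ 'n"
    by (simp add: matrix_mul_assoc[symmetric] ZN)
  ultimately have "A' = coeff_pp ?y ** ?A + coeff_pq ?y - ?A ** coeff_qq ?y - ?l *\<^sub>R (?A ** ?A)"
  proof -
    assume e: "(A' ** ?Z) ** ?N = (?P' - ?A ** ?Z') ** ?N" and c: "\<And>M :: real ^ 'n ^ 'n. M ** ?Z ** ?N = M"
    have bl: "bounded_linear (\<lambda>M. M ** ?N)"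
      by (rule bounded_bilinear.bounded_linear_left[OF bounded_bilinear_matrix_matrix_mult])
    have "(?P' - ?A ** ?Z') ** ?N = coeff_pq ?y ** ?Z ** ?N + coeff_pp ?y ** ?P ** ?N 
        - (?A ** (coeff_qq ?y ** ?Z) ** ?N + ?l *\<^sub>R (?A ** ?P ** ?N))"
      by (simp add: bounded_bilinear.diff_left[OF bounded_bilinear_matrix_matrix_mult]
          bounded_bilinear.add_left[OF bounded_bilinear_matrix_matrix_mult] bounded_bilinear.add_right[OF bounded_bilinear_matrix_matrix_mult]
          bounded_bilinear.scaleR_left[OF bounded_bilinear_matrix_matrix_mult] bounded_bilinear.scaleR_right[OF bounded_bilinear_matrix_matrix_mult])
    also have "\<dots> = coeff_pp ?y ** ?A + coeff_pq ?y - ?A ** coeff_qq ?y - ?l *\<^sub>R (?A ** ?A)"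
      using c[of "?A ** coeff_qq ?y"] c[of "coeff_pq ?y"] by (simp add: matrix_mul_assoc riccati_def)
    finally show ?thesis using e c by simp
  qed
  then show ?thesis using A' by simp
qed

text \<open>The graph is Lagrangian: the invariant form is evaluated on the two vectors of the graph
  lying over \<open>axis i 1\<close> and \<open>axis j 1\<close>.\<close>

lemma riccati_skew:
  assumes nc: "no_conj x" and t: "t > 0"
  shows "riccati x t $ i $ j - riccati x t $ j $ i = B (fst (\<Phi> t x)) $ i $ j"
proof -
  let ?N = "matrix_inv (jac_q x t)"
  have d: "det (jac_q x t) \<noteq> 0" using jac_q_det[OF nc] t by simp
  have q: "fst (D (\<Phi> t) x (0, ?N *v v)) = v" for v
    by (simp add: jac_q_mult[symmetric] matrix_vector_mul_assoc matrix_inv_inverse(1)[OF d])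
  have p: "snd (D (\<Phi> t) x (0, ?N *v v)) = riccati x t *v v" for v
    by (simp add: jac_p_mult[symmetric] matrix_vector_mul_assoc riccati_def)
  have col: "axis i 1 \<bullet> (M *v axis j 1) = M $ i $ j" for M :: "real ^ 'n ^ 'n" and i j
    by (simp add: matrix_vector_mult_basis column_def inner_axis' )
  show ?thesis
    using twisted_form_flow[OF refl refl, of t x "?N *v axis i 1" "?N *v axis j 1"]
    unfolding q p by (simp add: col inner_commute[of _ "axis j 1"])
qed

section \<open>The trace of the Riccati equation\<close>

definition lap :: "real ^ 'n \<Rightarrow> real" where
  "lap q = (\<Sum>i\<in>UNIV. D G q (axis i 1) $ i)"

definition form_sq :: "real ^ 'n \<Rightarrow> real" where
  "form_sq q = (\<Sum>i\<in>UNIV. \<Sum>j\<in>UNIV. (B q $ i $ j)\<^sup>2)"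

text \<open>This is the divergence in \<open>q\<close> of the magnetic force \<open>lam B p\<close>.\<close>

definition odd_part :: "'n phase \<Rightarrow> real" where
  "odd_part x = G (fst x) \<bullet> (B (fst x) *v snd x) + lam (fst x) * (\<Sum>i\<in>UNIV. (D B (fst x) (axis i 1) *v snd x) $ i)"

text \<open>With reversed sign, this is what the trace of the Riccati equation leaves after
  completing the square. The factor \<open>p \<bullet> p\<close> has been replaced by
  \<open>1 / lam\<close>, which is legitimate on the level \<open>en x = 1\<close>; momentum
  survives only in the odd part.\<close>

definition pot :: "'n phase \<Rightarrow> real" where
  "pot x = lam (fst x) / 4 * form_sq (fst x) + lap (fst x) / (2 * lam (fst x))
     - (G (fst x) \<bullet> G (fst x)) / (lam (fst x))\<^sup>2 - odd_part x"

lemma trace_coeff_pq: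
  "trace (coeff_pq x) = odd_part x - (snd x \<bullet> snd x / 2) * lap (fst x)"
proof -
  have "coeff_pq x $ i $ i = G (fst x) $ i * (B (fst x) *v snd x) $ i + lam (fst x) * (D B (fst x) (axis i 1) *v snd x) $ i
     - (snd x \<bullet> snd x / 2) * (D G (fst x) (axis i 1)) $ i" for i
    by (simp add: coeff_pq_def matrix_def inner_axis)
  then show ?thesis
    by (simp add: trace_def odd_part_def lap_def inner_vec_def sum.distrib sum_subtractf sum_distrib_left)
qed

lemma riccati_trace_deriv:
  assumes nc: "no_conj x" and t: "t > 0" and e: "en x = 1"
  shows "\<exists>u'. ((\<lambda>t. trace (riccati x t)) has_real_derivative u') (at t) \<and>
    u' \<le> - (lam (fst (\<Phi> t x)) / real CARD('n)) * (trace (riccati x t) 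
        + (G (fst (\<Phi> t x)) \<bullet> snd (\<Phi> t x)) / lam (fst (\<Phi> t x)))\<^sup>2 - pot (\<Phi> t x)"
proof -
  obtain q p where qp: "\<Phi> t x = (q, p)" by fastforce
  let ?A = "riccati x t"
  have lp: "lam q * (p \<bullet> p) = 1" using e en_flow[of t x] by (simp add: qp en_def)
  define A' where "A' = coeff_pp (q, p) ** ?A + coeff_pq (q, p) - ?A ** coeff_qq (q, p) - lam q *\<^sub>R (?A ** ?A)"
  have "(riccati x has_vector_derivative A') (at t)"
    using riccati_deriv[OF nc t] by (simp add: qp A'_def)
  moreover have "bounded_linear (trace :: real ^ 'n ^ 'n \<Rightarrow> real)"
    unfolding linear_conv_bounded_linear[symmetric]
    by (rule linearI) (simp_all add: trace_def sum.distrib sum_distrib_left)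
  ultimately have "((\<lambda>t. trace (riccati x t)) has_real_derivative trace A') (at t)"
    using bounded_linear.has_vector_derivative has_real_derivative_iff_has_vector_derivative by blast
  moreover have "trace A' = (\<Sum>i\<in>UNIV. \<Sum>j\<in>UNIV. lam q * B q $ i $ j * ?A $ j $ i - G q $ i * p $ j * ?A $ j $ i 
             - ?A $ i $ j * p $ j * G q $ i - lam q * ?A $ i $ j * ?A $ j $ i) 
       + (odd_part (q, p) - (p \<bullet> p / 2) * lap q)"
    using trace_coeff_pq[of "(q, p)"]
    by (simp add: A'_def trace_def matrix_matrix_mult_def coeff_pp_def coeff_qq_def sum.distrib sum_subtractf sum_distrib_left
       algebra_simps)
  moreover have "p \<bullet> p = 1 / lam q" using lp by (simp add: field_simps)
  ultimately show ?thesis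
    using riccati_trace_inequality[of "lam q" p ?A "B q" "G q", OF lam_pos lp] riccati_skew[OF nc t]
    by (intro exI[of _ "trace A'"]) (simp_all add: qp pot_def form_sq_def)
qed

end

section \<open>Averages over the energy level\<close>

text \<open>A truncation with one continuous derivative, which is all that the integrations by parts
  ask of the bump functions built from it.\<close>

definition pos_sq :: "real \<Rightarrow> real" where "pos_sq y = (max 0 y)\<^sup>2"

lemma pos_sq_deriv: "(pos_sq has_real_derivative 2 * max 0 y) (at y)"
proof -
  consider "y > 0" | "y < 0" | "y = 0" by linarith
  then show ?thesis
  proof cases
    case 1
    have "((\<lambda>y. y\<^sup>2) has_real_derivative 2 * y) (at y)"
      by (auto intro!: derivative_eq_intros)
    then show ?thesis
      by (rule has_field_derivative_transform_within_open[of _ _ _ "{0<..}", THEN DERIV_cong])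
         (use 1 in \<open>auto simp: pos_sq_def\<close>)
  next
    case 2
    have "((\<lambda>y. 0) has_real_derivative 0) (at y)" by simp
    then show ?thesis
      by (rule has_field_derivative_transform_within_open[of _ _ _ "{..<0}", THEN DERIV_cong])
         (use 2 in \<open>auto simp: pos_sq_def\<close>)
  next
    case 3
    have "((\<lambda>h. max 0 h) \<longlongrightarrow> (max 0 0 :: real)) (at 0)"
      by (intro tendsto_intros)
    moreover have "\<forall>\<^sub>F h in at 0. max 0 h = (pos_sq (0 + h) - pos_sq 0) / (h :: real)"
      by (rule eventually_at_topological[THEN iffD2], rule exI[of _ UNIV]) (auto simp: pos_sq_def max_def power2_eq_square)
    ultimately have "((\<lambda>h. (pos_sq (0 + h) - pos_sq 0) / h) \<longlongrightarrow> 0) (at 0)"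
      using tendsto_cong by fastforce
    then show ?thesis using 3 by (simp add: DERIV_def)
  qed
qed

lemma C1_real_fun:
  assumes "\<And>y. (f has_real_derivative f' y) (at y)" "continuous_on UNIV f'"
  shows "C1 f"
  by (rule C1I[of f "\<lambda>y v. v * f' y"])
    (use assms in \<open>auto simp: has_field_derivative_def mult.commute[of _ "f' _"] intro!: continuous_intros\<close>)

lemma C1_pos_sq: "C1 pos_sq"
  by (rule C1_real_fun[OF pos_sq_deriv]) (intro continuous_intros)

lemma C1_sqrt:
  fixes f :: "'a::real_normed_vector \<Rightarrow> real"
  assumes "C1 f" "\<And>x. f x > 0" shows "C1 (\<lambda>x. sqrt (f x))"
proof (rule C1I[where f'="\<lambda>x v. D f x v * (inverse (sqrt (f x)) / 2)"])
  show "((\<lambda>x. sqrt (f x)) has_derivative (\<lambda>v. D f x v * (inverse (sqrt (f x)) / 2))) (at x)" for x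
    using has_derivative_real_sqrt[OF assms(2) C1_has_derivative[OF assms(1)]] by (simp add: field_simps)
  show "continuous_on UNIV (\<lambda>x. D f x v * (inverse (sqrt (f x)) / 2))" for v
    using assms(2) less_irrefl
    by (auto intro!: continuous_intros C1_continuous[OF assms(1)] C1_continuous_D[OF assms(1)]) (metis less_irrefl)
qed

text \<open>The bump \<open>cut\<close> is supported in \<open>[1, 3]\<close>; \<open>isq\<close> is a positive \<open>C\<^sup>1\<close> function on the whole line that
  equals \<open>1 / sqrt y\<close> for \<open>y \<ge> 1\<close>, in particular on the support of \<open>cut\<close>.\<close>

definition cut :: "real \<Rightarrow> real" where "cut y = pos_sq ((y - 1) * (3 - y))"
definition isq :: "real \<Rightarrow> real" where "isq y = inverse (sqrt (y + pos_sq (1 - y)))"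
text \<open>On the support of \<open>cut\<close> this is \<open>sqrt y * cut y\<close>. The factor
  is chosen to make \<open>wt y * isq y = cut y\<close> hold everywhere, which is what matches the
  field \<open>scaled_vf\<close> with \<open>X\<close> after normalization.\<close>

definition wt :: "real \<Rightarrow> real" where "wt y = y * isq y * cut y"

text \<open>Below 1 the sum is a parabola with minimum \<open>3 / 4\<close>, so the root and its
  inverse are differentiable on the whole line and no domain conditions arise.\<close>

lemma isq_arg_pos: "y + pos_sq (1 - y) > 0"
proof (cases "y \<le> 1")
  case True
  have "y + (1 - y)\<^sup>2 = (y - 1 / 2)\<^sup>2 + 3 / 4" by (simp add: power2_eq_square field_simps)
  also have "\<dots> > 0" using zero_le_power2[of "y - 1 / 2"] by linarith
  finally show ?thesis using True by (simp add: pos_sq_def)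
qed (simp add: pos_sq_def)

lemma isq_pos: "isq y > 0"
  using isq_arg_pos by (simp add: isq_def)

lemma C1_cut: "C1 cut"
  unfolding cut_def by (intro C1_compose[OF C1_pos_sq] C1_intros)

lemma C1_isq: "C1 isq"
proof -
  have "sqrt (y + pos_sq (1 - y)) \<noteq> 0" for y using isq_arg_pos[of y] by simp
  then show ?thesis
    unfolding isq_def by (intro C1_inverse C1_sqrt isq_arg_pos C1_add C1_compose[OF C1_pos_sq] C1_intros)
qed

lemma C1_wt: "C1 wt"
  unfolding wt_def by (intro C1_intros C1_cut C1_isq)

lemma cut_nonzero: "cut y \<noteq> 0 \<Longrightarrow> 1 < y \<and> y < 3"
proof -
  assume "cut y \<noteq> 0"
  then have "0 < (y - 1) * (3 - y)"
    by (cases "0 < (y - 1) * (3 - y)") (auto simp: cut_def pos_sq_def max_absorb1)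
  then show ?thesis by (auto simp: zero_less_mult_iff)
qed

lemma cut_nonneg: "cut y \<ge> 0" by (simp add: cut_def pos_sq_def)

lemma cut_2: "cut 2 = 1" by (simp add: cut_def pos_sq_def)

lemma isq_sq: "y \<ge> 1 \<Longrightarrow> y * (isq y)\<^sup>2 = 1"
  by (simp add: isq_def pos_sq_def power_inverse)

lemma wt_isq: "wt y * isq y = cut y"
  using isq_sq[of y] cut_nonzero[of y] by (cases "cut y = 0") (simp_all add: wt_def power2_eq_square algebra_simps)

lemma wt_support: "y \<ge> 3 \<Longrightarrow> wt y = 0" "y \<le> 1 \<Longrightarrow> wt y = 0" "y \<ge> 3 \<Longrightarrow> cut y = 0"
  using cut_nonzero[of y] by (auto simp: wt_def)

lemma wt_nonneg: "y \<ge> 0 \<Longrightarrow> wt y \<ge> 0"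
  using isq_pos[of y] cut_nonneg[of y] by (simp add: wt_def)

section \<open>Compactness modulo the lattice\<close>

lemma lattice_cell:
  fixes A :: "real ^ 'n::finite \<Rightarrow> real ^ 'n"
  assumes "linear A" "surj A" "\<forall>s. (\<forall>i. s $ i \<in> \<int>) \<longrightarrow> A s \<in> L"
  obtains s l where "s \<in> cbox 0 1" "l \<in> L" "A s = q + l"
proof -
  obtain s0 where s0: "q = A s0" using assms(2) by blast
  define k :: "real ^ 'n" where "k = (\<chi> i. - of_int \<lfloor>s0 $ i\<rfloor>)"
  have "A (s0 + k) = q + A k" by (simp add: s0 linear_add[OF assms(1)])
  moreover have "A k \<in> L" by (rule assms(3)[rule_format]) (simp add: k_def)
  moreover have "s0 + k \<in> cbox 0 1"
  proof -
    have "of_int \<lfloor>s0 $ i\<rfloor> \<le> s0 $ i" "s0 $ i \<le> of_int \<lfloor>s0 $ i\<rfloor> + 1" for i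
      using floor_correct[of "s0 $ i"] by linarith+
    then show ?thesis by (simp add: mem_box_cart k_def algebra_simps)
  qed
  ultimately show thesis using that by blast
qed

lemma periodic_attains_inf:
  fixes h :: "real ^ 'n::finite \<Rightarrow> real"
  assumes "lattice L" "periodic L h" "continuous_on UNIV h"
  obtains q0 where "\<And>q. h q0 \<le> h q"
proof -
  obtain A :: "real ^ 'n \<Rightarrow> real ^ 'n" where A: "linear A" "surj A" "\<forall>s. (\<forall>i. s $ i \<in> \<int>) \<longrightarrow> A s \<in> L"
    using lattice_linear[OF assms(1)] by blast
  have "continuous_on (cbox 0 1) (\<lambda>s. h (A s))"
    using continuous_on_compose2[OF assms(3) linear_continuous_on] A(1) 
    by (simp add: linear_conv_bounded_linear)
  moreover have "cbox 0 (1 :: real ^ 'n) \<noteq> {}" by (simp add: interval_ne_empty_cart)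
  ultimately have "\<exists>s0\<in>cbox 0 1. \<forall>s\<in>cbox 0 1. h (A s0) \<le> h (A s)"
    using continuous_attains_inf[OF compact_cbox, of 0 "1 :: real ^ 'n" "\<lambda>s. h (A s)"] by simp
  then obtain s0 where s0: "\<And>s. s \<in> cbox 0 1 \<Longrightarrow> h (A s0) \<le> h (A s)" by blast
  have "h (A s0) \<le> h q" for q
  proof -
    obtain s l where "s \<in> cbox 0 1" "l \<in> L" "A s = q + l" by (rule lattice_cell[OF A])
    then show ?thesis using s0[of s] assms(2) by (simp add: periodic_def)
  qed
  then show thesis by (rule that)
qed

context conformal_magnetic
begin

lemma lam_lower_bound: obtains m where "m > 0" "\<And>q. m \<le> lam q"
  using periodic_attains_inf[OF L lam_periodic C1_continuous[OF C1_lam]] lam_pos by metis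

text \<open>On the unit level Cauchy-Schwarz bounds the square by the periodic continuous function
  \<open>G q \<bullet> G q / lam q ^ 3\<close>. The quantity is the shift accompanying the trace in
  the Riccati inequality; \<open>?h\<close> carries a minus sign because extrema are supplied as
  minima.\<close>

lemma conformal_bound: obtains K where "K \<ge> 0" "\<And>q (p :: real ^ 'n). lam q * (p \<bullet> p) = 1 \<Longrightarrow> \<bar>(G q \<bullet> p) / lam q\<bar> \<le> K"
proof -
  let ?h = "\<lambda>q. - (G q \<bullet> G q / lam q ^ 3)"
  have "continuous_on UNIV ?h"
    by (intro continuous_intros C1_continuous C1_G C1_lam) simp
  moreover have "periodic L ?h" by (simp add: periodic_def G_periodic)
  ultimately obtain q0 where q0: "\<And>q. ?h q0 \<le> ?h q" using periodic_attains_inf[OF L] by blast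
  show thesis
  proof (rule that[of "sqrt (- ?h q0)"])
    show "0 \<le> sqrt (- ?h q0)" using lam_pos[of q0] by simp
    fix q and p :: "real ^ 'n" assume lp: "lam q * (p \<bullet> p) = 1"
    have "((G q \<bullet> p) / lam q)\<^sup>2 \<le> (G q \<bullet> G q) * (p \<bullet> p) / (lam q)\<^sup>2"
      using Cauchy_Schwarz_ineq[of "G q" p] by (simp add: power_divide divide_right_mono)
    also have "p \<bullet> p = 1 / lam q" using lp by (simp add: field_simps)
    also have "(G q \<bullet> G q) * (1 / lam q) / (lam q)\<^sup>2 = - ?h q" by (simp add: power2_eq_square power3_eq_cube)
    also have "\<dots> \<le> - ?h q0" using q0[of q] by simp
    finally show "\<bar>(G q \<bullet> p) / lam q\<bar> \<le> sqrt (- ?h q0)"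
      using real_sqrt_le_mono by fastforce
  qed
qed

lemma C1_lap: "C1 lap"
proof -
  have "lap = (\<lambda>q. \<Sum>i\<in>UNIV. D (\<lambda>q. D lam q (axis i 1)) q (axis i 1))"
    by (simp add: fun_eq_iff lap_def D_D_lam inner_axis)
  then show ?thesis by (simp only:) (intro C1_sum smooth_C1 smooth_D lam_smooth)
qed

lemma C1_odd_part: "C1 odd_part"
proof -
  have "D B q v = (\<chi> i j. D (\<lambda>q. \<beta> q (axis i 1) (axis j 1)) q v)" for q v
    by (simp add: D_form vec_eq_iff inner_axis' matrix_vector_mult_basis column_def)
  moreover have "C1 (\<lambda>q. \<chi> i j. D (\<lambda>q. \<beta> q (axis i 1) (axis j 1)) q v)" for v
    by (intro C1_intros smooth_C1 smooth_D) (use form in \<open>auto simp: two_form_def smooth_tensor2_def\<close>)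
  ultimately have DB: "C1 (\<lambda>q. D B q v)" for v by simp
  show ?thesis
    unfolding odd_part_def by (intro C1_comp_intros C1_compose[OF DB])
qed

lemma C1_pot: "C1 pot"
  unfolding pot_def form_sq_def by (intro C1_comp_intros C1_compose[OF C1_lap] C1_odd_part) auto

text \<open>Testing the Riccati inequality with \<open>\<phi>\<^sup>2\<close>, where \<open>\<phi>\<close> vanishes at both ends, needs no bound on the
  Riccati solution itself.\<close>

lemma orbit_inequality:
  obtains c K where "c > 0" "K \<ge> 0"
    "\<And>x T. no_conj x \<Longrightarrow> en x = 1 \<Longrightarrow> T > 0 \<Longrightarrow>
       integral {1..1 + T} (\<lambda>t. ((t - 1) * (1 + T - t))\<^sup>2 * pot (\<Phi> t x)) \<le> T ^ 3 / c + K * T ^ 4 / 2"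
proof -
  obtain m where m: "m > 0" "\<And>q. m \<le> lam q" using lam_lower_bound by blast
  obtain K where K: "K \<ge> 0" "\<And>q (p :: real ^ 'n). lam q * (p \<bullet> p) = 1 \<Longrightarrow> \<bar>(G q \<bullet> p) / lam q\<bar> \<le> K" using conformal_bound by blast
  define c where "c = m / real CARD('n)"
  have c: "c > 0" using m by (simp add: c_def)
  show thesis
  proof (rule that[OF c K(1)])
    fix x T assume nc: "no_conj x" and e: "en x = 1" and T: "T > (0::real)"
    define u where "u t = trace (riccati x t)" for t
    define f where "f t = pot (\<Phi> t x)" for t
    \<comment> \<open>The interval starts at 1 to stay away from the singularity at time 0. On it
      the polynomial is at most \<open>T\<^sup>2 / 4\<close>, its value at the midpoint, and its
      derivative is at most \<open>T\<close> in absolute value.\<close>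
    define \<phi> where "\<phi> t = (t - 1) * (1 + T - t)" for t :: real
    define \<phi>' where "\<phi>' t = 2 + T - 2 * t" for t :: real
    define mm where "mm t = (G (fst (\<Phi> t x)) \<bullet> snd (\<Phi> t x)) / lam (fst (\<Phi> t x))" for t
    have mmK: "\<bar>mm t\<bar> \<le> K" for t
      using K(2)[of "fst (\<Phi> t x)" "snd (\<Phi> t x)"] en_flow[of t x] e by (simp add: mm_def en_def)
    have "\<exists>u'. (u has_real_derivative u') (at t) \<and> u' \<le> - c * (u t + mm t)\<^sup>2 - f t" if t: "t > 0" for t
    proof -
      obtain u' where "(u has_real_derivative u') (at t)" and
         u': "u' \<le> - (lam (fst (\<Phi> t x)) / real CARD('n)) * (u t + mm t)\<^sup>2 - f t"
        using riccati_trace_deriv[OF nc t e] unfolding u_def f_def mm_def by blast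
      moreover have "c * (u t + mm t)\<^sup>2 \<le> (lam (fst (\<Phi> t x)) / real CARD('n)) * (u t + mm t)\<^sup>2"
        unfolding c_def using m by (intro mult_right_mono divide_right_mono) auto
      ultimately show ?thesis by (intro exI[of _ u']) auto
    qed
    then obtain u' where u': "\<And>t. t > 0 \<Longrightarrow> (u has_real_derivative u' t) (at t)"
        "\<And>t. t > 0 \<Longrightarrow> u' t \<le> - c * (u t + mm t)\<^sup>2 - f t" by metis
    define w where "w t = 2 * \<phi> t * \<phi>' t * u t + (\<phi> t)\<^sup>2 * u' t" for t
    have "((\<lambda>t. (\<phi> t)\<^sup>2 * u t) has_vector_derivative w t) (at t within {1..1 + T})" if "t \<in> {1..1 + T}" for t
    proof -
      have "((\<lambda>t. (\<phi> t)\<^sup>2 * u t) has_real_derivative w t) (at t)"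
        unfolding w_def \<phi>_def using that
        by (auto intro!: derivative_eq_intros u' simp: \<phi>'_def power2_eq_square algebra_simps)
      then show ?thesis
        by (simp add: has_real_derivative_iff_has_vector_derivative has_vector_derivative_at_within)
    qed
    then have w: "(w has_integral 0) {1..1 + T}"
      using fundamental_theorem_of_calculus[of 1 "1 + T" "\<lambda>t. (\<phi> t)\<^sup>2 * u t" w] T by (simp add: \<phi>_def)
    have "continuous_on UNIV (\<lambda>t. \<Phi> t x)"
      by (intro C1_continuous C1_flow_comp C1_intros)
    then have "continuous_on {1..1 + T} (\<lambda>t. \<Phi> t x)" using continuous_on_subset by blast
    then have "continuous_on {1..1 + T} f"
      unfolding f_def using continuous_on_compose2[OF C1_continuous[OF C1_pot]] by blast
    then have "(\<lambda>t. (\<phi> t)\<^sup>2 * f t) integrable_on {1..1 + T}"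
      unfolding \<phi>_def by (intro integrable_continuous_real continuous_intros)
    then have i: "((\<lambda>t. (\<phi> t)\<^sup>2 * f t) has_integral integral {1..1 + T} (\<lambda>t. (\<phi> t)\<^sup>2 * f t)) {1..1 + T}"
      by (rule integrable_integral)
    have j: "((\<lambda>t. T\<^sup>2 / c + K * T ^ 3 / 2) has_integral (1 + T - 1) *\<^sub>R (T\<^sup>2 / c + K * T ^ 3 / 2)) {1..1 + T}"
      using has_integral_const_real[of "T\<^sup>2 / c + K * T ^ 3 / 2" 1 "1 + T"] T by simp
    have "0 + integral {1..1 + T} (\<lambda>t. (\<phi> t)\<^sup>2 * f t) \<le> (1 + T - 1) *\<^sub>R (T\<^sup>2 / c + K * T ^ 3 / 2)"
    proof (rule has_integral_le[OF has_integral_add[OF w i] j])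
      fix t assume t: "t \<in> {1..1 + T}"
      define a where "a = \<phi> t" define b where "b = \<phi>' t" define y where "y = u t + mm t"
      have a: "0 \<le> a" "a \<le> T\<^sup>2 / 4"
      proof -
        show "0 \<le> a" using t by (simp add: a_def \<phi>_def)
        have "T\<^sup>2 / 4 - a = (t - 1 - T / 2)\<^sup>2" by (simp add: a_def \<phi>_def power2_eq_square field_simps)
        then show "a \<le> T\<^sup>2 / 4" using zero_le_power2[of "t - 1 - T / 2"] by linarith
      qed
      have b: "\<bar>b\<bar> \<le> T" using t by (auto simp: b_def \<phi>'_def)
      have "w t + a\<^sup>2 * f t \<le> 2 * a * b * u t + a\<^sup>2 * (- c * y\<^sup>2 - f t) + a\<^sup>2 * f t"
        using mult_left_mono[OF u'(2)[of t] zero_le_power2[of a]] t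
        unfolding w_def a_def[symmetric] b_def[symmetric] y_def[symmetric] by simp
      \<comment> \<open>Completing the square in \<open>y\<close> removes the uncontrolled trace.
        Since \<open>u t = y - mm t\<close>, the only other remainder is linear in the bounded
        quantity \<open>mm t\<close>.\<close>
      also have "\<dots> = b\<^sup>2 / c - (b - c * a * y)\<^sup>2 / c - 2 * a * b * mm t"
        using c by (simp add: y_def power2_eq_square field_simps)
      also have "\<dots> \<le> T\<^sup>2 / c + K * T ^ 3 / 2"
      proof -
        have "b\<^sup>2 / c \<le> T\<^sup>2 / c" using b c T by (intro divide_right_mono) (auto simp: abs_le_square_iff[symmetric])
        moreover have "(b - c * a * y)\<^sup>2 / c \<ge> 0" using c by simp
        moreover have "\<bar>2 * a * b * mm t\<bar> \<le> 2 * (T\<^sup>2 / 4) * T * K"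
          unfolding abs_mult using a b mmK[of t] K(1) T by (intro mult_mono) auto
        moreover have "2 * (T\<^sup>2 / 4) * T * K = K * T ^ 3 / 2" by (simp add: power2_eq_square power3_eq_cube)
        moreover have "- (2 * a * b * mm t) \<le> \<bar>2 * a * b * mm t\<bar>" by (rule abs_ge_minus_self)
        ultimately show ?thesis by linarith
      qed
      finally show "w t + (\<phi> t)\<^sup>2 * f t \<le> T\<^sup>2 / c + K * T ^ 3 / 2" by (simp add: a_def)
    qed
    also have "(1 + T - 1) *\<^sub>R (T\<^sup>2 / c + K * T ^ 3 / 2) = T ^ 3 / c + K * T ^ 4 / 2"
      by (simp add: power2_eq_square power3_eq_cube power4_eq_xxxx field_simps)
    finally show "integral {1..1 + T} (\<lambda>t. ((t - 1) * (1 + T - t))\<^sup>2 * pot (\<Phi> t x)) \<le> T ^ 3 / c + K * T ^ 4 / 2"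
      by (simp add: \<phi>_def f_def)
  qed
qed

end

section \<open>Integration by parts on the cotangent bundle of the torus\<close>

lemma continuous_on_UNIV_compose:
  "continuous_on UNIV f \<Longrightarrow> continuous_on S g \<Longrightarrow> continuous_on S (\<lambda>x. f (g x))"
  by (rule continuous_on_compose2[of UNIV f S g]) auto

lemma linear_phase_sum:
  fixes f :: "'n::finite phase \<Rightarrow> 'b::real_normed_vector"
  assumes "linear f"
  shows "f w = (\<Sum>i\<in>UNIV. (fst w $ i) *\<^sub>R f (axis i 1, 0) + (snd w $ i) *\<^sub>R f (0, axis i 1))"
proof -
  have e: "(\<Sum>i\<in>UNIV. (x $ i) *\<^sub>R axis i (1::real)) = x" for x :: "real ^ 'n"
    using basis_expansion[of x] by (simp add: scalar_mult_eq_scaleR)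
  have "w = (\<Sum>i\<in>UNIV. (fst w $ i) *\<^sub>R (axis i 1, 0) + (snd w $ i) *\<^sub>R (0, axis i 1))"
    by (simp add: prod_eq_iff fst_sum snd_sum e)
  then have "f w = f (\<Sum>i\<in>UNIV. (fst w $ i) *\<^sub>R (axis i 1, 0) + (snd w $ i) *\<^sub>R (0, axis i 1))"
    by (rule arg_cong)
  then show ?thesis
    by (simp only: linear_sum[OF assms] linear_add[OF assms] linear_scale[OF assms])
qed

locale conformal_magnetic_cell = conformal_magnetic L lam \<beta> \<Phi>
  for L :: "(real ^ 'n::finite) set" and lam \<beta> \<Phi> +
  fixes cell :: "real ^ 'n \<Rightarrow> real ^ 'n" and m :: real
  assumes cell_linear: "linear cell" and cell_surj: "surj cell"
    and cell_lattice: "\<forall>s. (\<forall>i. s $ i \<in> \<int>) \<longrightarrow> cell s \<in> L"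
    and m_pos: "m > 0" and m_le: "m \<le> lam q"
begin

text \<open>If \<open>en x \<le> 3\<close>, each squared momentum coordinate is at most
  \<open>3 / m\<close>, and \<open>\<bar>a\<bar> \<le> a\<^sup>2 + 1\<close> bounds the coordinate
  by \<open>3 / m + 1\<close> without a root. The extra unit leaves a margin inside the box where
  admissible functions vanish.\<close>

definition rad :: real where "rad = 3 / m + 2"

definition lo :: "'n phase" where "lo = (0, \<chi> i. - rad)"
definition hi :: "'n phase" where "hi = (1, \<chi> i. rad)"

definition chart :: "'n phase \<Rightarrow> 'n phase" where "chart y = (cell (fst y), snd y)"

text \<open>Integration over the cotangent bundle of the torus, in coordinates where the fundamental cell is a
  cube, of functions supported in the sublevel set \<open>en < 3\<close>.\<close>

definition avg :: "('n phase \<Rightarrow> real) \<Rightarrow> real" where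
  "avg f = integral (cbox lo hi) (\<lambda>y. f (chart y))"

definition invariant :: "('n phase \<Rightarrow> 'b) \<Rightarrow> bool" where
  "invariant f \<longleftrightarrow> (\<forall>l\<in>L. \<forall>x. f (x + (l, 0)) = f x)"

definition admissible :: "('n phase \<Rightarrow> 'b::real_normed_vector) \<Rightarrow> bool" where
  "admissible f \<longleftrightarrow> C1 f \<and> invariant f \<and> (\<forall>x. en x \<ge> 3 \<longrightarrow> f x = 0)"

lemma rad_ge: "rad \<ge> 2" using m_pos by (simp add: rad_def)

lemma chart_linear: "linear chart"
  by (rule linearI) (simp_all add: chart_def linear_add[OF cell_linear] linear_scale[OF cell_linear])

lemma chart_surj: "surj chart"
proof -
  have "\<exists>y. chart y = x" for x
  proof -
    obtain s where "cell s = fst x" using cell_surj by (metis surjD)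
    then show ?thesis by (intro exI[of _ "(s, snd x)"]) (simp add: chart_def)
  qed
  then show ?thesis by (metis surjI)
qed

lemma C1_chart: "C1 chart"
  using chart_linear by (intro C1_bounded_linear) (simp add: linear_conv_bounded_linear)

lemma continuous_on_chart: "continuous_on UNIV f \<Longrightarrow> continuous_on S (\<lambda>y. f (chart y))"
  by (rule continuous_on_UNIV_compose[where g=chart]) (auto intro: continuous_on_subset[OF C1_continuous[OF C1_chart]])

lemma avg_integrable: "continuous_on UNIV f \<Longrightarrow> (\<lambda>y. f (chart y)) integrable_on cbox lo hi"
  for f :: "'n phase \<Rightarrow> real"
  by (rule integrable_continuous) (rule continuous_on_chart)

lemma avg_add: "continuous_on UNIV f \<Longrightarrow> continuous_on UNIV g \<Longrightarrow> avg (\<lambda>x. f x + g x) = avg f + avg g"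
  unfolding avg_def by (rule integral_add[OF avg_integrable avg_integrable])

lemma avg_diff: "continuous_on UNIV f \<Longrightarrow> continuous_on UNIV g \<Longrightarrow> avg (\<lambda>x. f x - g x) = avg f - avg g"
  unfolding avg_def by (rule integral_diff[OF avg_integrable avg_integrable])

lemma avg_cmult: "avg (\<lambda>x. c * f x) = c * avg f"
  unfolding avg_def by simp

lemma avg_sum: "finite S \<Longrightarrow> (\<And>i. i \<in> S \<Longrightarrow> continuous_on UNIV (f i)) \<Longrightarrow> avg (\<lambda>x. \<Sum>i\<in>S. f i x) = (\<Sum>i\<in>S. avg (f i))"
  unfolding avg_def by (rule integral_sum) (auto intro: avg_integrable)

lemma avg_mono: "continuous_on UNIV f \<Longrightarrow> continuous_on UNIV g \<Longrightarrow> (\<And>x. f x \<le> g x) \<Longrightarrow> avg f \<le> avg g"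
  unfolding avg_def by (rule integral_le[OF avg_integrable avg_integrable])

lemma momentum_bound:
  assumes "en x \<le> 3" shows "\<bar>snd x $ i\<bar> \<le> rad - 1"
proof -
  have "m * (snd x $ i)\<^sup>2 \<le> lam (fst x) * (snd x \<bullet> snd x)"
  proof (rule mult_mono)
    show "(snd x $ i)\<^sup>2 \<le> snd x \<bullet> snd x"
      unfolding inner_vec_def power2_eq_square by (simp, rule member_le_sum) auto
  qed (use m_le m_pos lam_pos in \<open>auto simp: less_imp_le\<close>)
  also have "\<dots> \<le> 3" using assms by (simp add: en_def)
  finally have "(snd x $ i)\<^sup>2 \<le> 3 / m" using m_pos by (simp add: field_simps)
  moreover have "\<bar>snd x $ i\<bar> \<le> (snd x $ i)\<^sup>2 + 1"
    using zero_le_power2[of "\<bar>snd x $ i\<bar> - 1"] by (simp add: power2_diff) 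
  ultimately show ?thesis by (simp add: rad_def)
qed

lemma chart_axis: "chart (y + (axis i 1, 0)) = chart y + (cell (axis i 1), 0)"
  by (simp add: chart_def linear_add[OF cell_linear])

lemma cell_axis: "cell (axis i 1) \<in> L"
  using cell_lattice by (simp add: axis_def)

text \<open>A unit step in a cell direction is a lattice translation, so the function is periodic
  there; in a momentum direction it vanishes near both faces.\<close>

lemma avg_D_chart:
  assumes f: "admissible f" and k: "k \<in> Basis"
  shows "avg (\<lambda>x. D f x (chart k)) = 0"
proof -
  have f1: "C1 f" and f2: "\<And>l x. l \<in> L \<Longrightarrow> f (x + (l, 0)) = f x" and f3: "\<And>x. en x \<ge> 3 \<Longrightarrow> f x = 0"
    using f by (auto simp: admissible_def invariant_def)
  define F where "F y = f (chart y)" for y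
  have F: "C1 F" unfolding F_def by (rule C1_compose[OF f1 C1_chart])
  have DF: "D F y w = D f (chart y) (chart w)" for y w
  proof -
    have "(F has_derivative (\<lambda>w. D f (chart y) (chart w))) (at y)"
      unfolding F_def using has_derivative_compose[OF bounded_linear_imp_has_derivative C1_has_derivative[OF f1]]
        chart_linear by (simp add: linear_conv_bounded_linear)
    from D_eq[OF this] show ?thesis by simp
  qed
  have "integral (cbox lo hi) (\<lambda>y. D F y k) = 0"
  proof -
    consider i where "k = (axis i 1, 0)" | i where "k = (0, axis i 1)"
      using k by (auto simp: Basis_prod_def Basis_vec_def)
    then show ?thesis
    proof cases
      case 1
      show ?thesis
        by (rule integral_derivative_periodic_box[OF F k zero_less_one])
          (simp_all add: 1 lo_def hi_def inner_axis F_def chart_axis f2 cell_axis)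
    next
      case 2
      have bk: "lo \<bullet> k = - rad" "hi \<bullet> k = rad" "y \<bullet> k = snd y $ i" for y
        by (simp_all add: 2 lo_def hi_def inner_axis inner_prod_def)
      have z: "F y = 0" if "\<bar>snd y $ i\<bar> > rad - 1" for y
        using momentum_bound[of "chart y" i] that f3[of "chart y"] by (force simp: F_def chart_def)
      show ?thesis
      \<comment> \<open>In the slab of width \<open>1 / 2\<close>, and also after the shift by
        \<open>2 * rad\<close>, the coordinate exceeds \<open>rad - 1\<close> in absolute value;
        both values of \<open>F\<close> are therefore 0.\<close>
      proof (rule integral_derivative_periodic_box[OF F k, of "1 / 2"])
        fix y assume "lo \<bullet> k \<le> y \<bullet> k" "y \<bullet> k \<le> lo \<bullet> k + 1 / 2"
        then have y: "- rad \<le> snd y $ i" "snd y $ i \<le> - rad + 1 / 2" by (simp_all only: bk(1) bk(3)[of y])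
        have "F y = 0" using y rad_ge by (intro z) linarith
        moreover have "snd (y + (hi \<bullet> k - lo \<bullet> k) *\<^sub>R k) $ i = snd y $ i + 2 * rad"
          unfolding bk(1,2) by (simp add: 2)
        then have "F (y + (hi \<bullet> k - lo \<bullet> k) *\<^sub>R k) = 0"
          using y rad_ge by (intro z) linarith
        ultimately show "F (y + (hi \<bullet> k - lo \<bullet> k) *\<^sub>R k) = F y" by simp
      qed (use rad_ge bk(1,2) in auto)
    qed
  qed
  then show ?thesis by (simp add: avg_def DF)
qed

lemma avg_D:
  assumes f: "admissible f" shows "avg (\<lambda>x. D f x v) = 0"
proof -
  have f1: "C1 f" using f by (simp add: admissible_def)
  obtain w where v: "v = chart w" using chart_surj by blast
  have "D f x v = (\<Sum>k\<in>Basis. (w \<bullet> k) * D f x (chart k))" for x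
    using linear_euclidean_sum[OF linear_compose[OF chart_linear linear_D[OF f1]], of x w] by (simp add: v o_def)
  then show ?thesis
    by (simp add: avg_sum continuous_on_mult_left C1_continuous_D[OF f1] avg_cmult avg_D_chart[OF f])
qed

definition divg :: "('n phase \<Rightarrow> 'n phase) \<Rightarrow> 'n phase \<Rightarrow> real" where
  "divg V x = (\<Sum>i\<in>UNIV. fst (D V x (axis i 1, 0)) $ i + snd (D V x (0, axis i 1)) $ i)"

text \<open>The divergence theorem for \<open>g\<close> times \<open>V\<close>: each coordinate of
  the product is admissible, and its derivative in its own direction has mean zero.\<close>

lemma avg_divergence:
  assumes V: "admissible V" and g: "C1 g" "invariant g"
  shows "avg (\<lambda>x. D g x (V x) + g x * divg V x) = 0"
proof -
  have V1: "C1 V" using V by (simp add: admissible_def)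
  let ?a = "\<lambda>i x. g x * fst (V x) $ i" and ?b = "\<lambda>i x. g x * snd (V x) $ i"
  have ab: "admissible (?a i)" "admissible (?b i)" for i
    using V g by (auto simp: admissible_def invariant_def intro!: C1_intros)
  have D: "D (?a i) x w = g x * fst (D V x w) $ i + D g x w * fst (V x) $ i" 
    "D (?b i) x w = g x * snd (D V x w) $ i + D g x w * snd (V x) $ i" for i x w
  proof -
    have "(?a i has_derivative (\<lambda>w. g x * fst (D V x w) $ i + D g x w * fst (V x) $ i)) (at x)"
      by (intro has_derivative_mult C1_has_derivative g bounded_linear.has_derivative[OF bounded_linear_vec_nth]
          has_derivative_fst V1)
    from D_eq[OF this] show "D (?a i) x w = g x * fst (D V x w) $ i + D g x w * fst (V x) $ i" by simp
    have "(?b i has_derivative (\<lambda>w. g x * snd (D V x w) $ i + D g x w * snd (V x) $ i)) (at x)"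
      by (intro has_derivative_mult C1_has_derivative g bounded_linear.has_derivative[OF bounded_linear_vec_nth]
          has_derivative_snd V1)
    from D_eq[OF this] show "D (?b i) x w = g x * snd (D V x w) $ i + D g x w * snd (V x) $ i" by simp
  qed
  have "D g x (V x) + g x * divg V x = (\<Sum>i\<in>UNIV. D (?a i) x (axis i 1, 0) + D (?b i) x (0, axis i 1))" for x
    using linear_phase_sum[OF linear_D[OF g(1), of x], of "V x"]
    by (simp add: D divg_def sum.distrib sum_distrib_left algebra_simps)
  moreover have c: "continuous_on UNIV (\<lambda>x. D (?a i) x w)" "continuous_on UNIV (\<lambda>x. D (?b i) x w)" for i w
    using ab by (auto simp: admissible_def intro!: C1_continuous_D)
  have "avg (\<lambda>x. D (?a i) x (axis i 1, 0) + D (?b i) x (0, axis i 1)) = 0" for i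
    by (simp only: avg_add[OF c] avg_D[OF ab(1)] avg_D[OF ab(2)] add_0)
  then have "avg (\<lambda>x. \<Sum>i\<in>UNIV. D (?a i) x (axis i 1, 0) + D (?b i) x (0, axis i 1)) = 0"
    by (subst avg_sum) (simp_all add: continuous_on_add c)
  ultimately show ?thesis by simp
qed

lemma avg_divg: "admissible V \<Longrightarrow> avg (divg V) = 0"
  using avg_divergence[of V "\<lambda>x. 1"] C1_const[of "1::real"] D_eq[OF has_derivative_const[of "1::real"]]
  by (simp add: invariant_def)

lemma avg_odd:
  assumes "continuous_on UNIV f" "\<And>q p. f (q, - p) = - f (q, p)" shows "avg f = 0"
proof -
  have "continuous_on (cbox lo hi) (\<lambda>(s, p). f (cell s, p))"
    using continuous_on_chart[OF assms(1)] by (simp add: chart_def split_beta)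
  then have "avg f = integral (cbox 0 1) (\<lambda>s. integral (cbox (\<chi> i. - rad) (\<chi> i. rad)) (\<lambda>p. f (cell s, p)))"
    using integral_prod_continuous[of 0 "\<chi> i. - rad" 1 "\<chi> i. rad" "\<lambda>y. f (cell (fst y), snd y)"]
    by (simp add: lo_def hi_def avg_def chart_def split_beta)
  moreover have "integral (cbox (\<chi> i. - rad) (\<chi> i. rad)) (\<lambda>p. f (cell s, p)) = 0" for s
  proof -
    have "- (\<chi> i. rad) = ((\<chi> i. - rad) :: real ^ 'n)" "- (\<chi> i. - rad) = ((\<chi> i. rad) :: real ^ 'n)" by (simp_all add: vec_eq_iff)
    then have "integral (cbox (\<chi> i. - rad) (\<chi> i. rad)) (\<lambda>p. f (cell s, - p)) 
       = integral (cbox (\<chi> i. - rad) (\<chi> i. rad)) (\<lambda>p. f (cell s, p))"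
      using integral_reflect[of "\<chi> i. rad" "\<chi> i. - rad" "\<lambda>p. f (cell s, p)"] by simp
    then show ?thesis by (simp add: assms(2))
  qed
  ultimately show ?thesis by simp
qed

section \<open>The unit-level dynamics extended to a band of energies\<close>

lemma has_derivative_comp_en:
  "C1 f \<Longrightarrow> ((\<lambda>x. f (en x)) has_derivative (\<lambda>w. D en x w * D f (en x) 1)) (at x)" for f :: "real \<Rightarrow> real"
proof -
  assume f: "C1 f"
  have "D f (en x) a = a * D f (en x) 1" for a
    using linear_scale[OF linear_D[OF f], of "en x" a 1] by simp
  then have "(\<lambda>w. D f (en x) (D en x w)) = (\<lambda>w. D en x w * D f (en x) 1)" by (rule ext)
  with has_derivative_compose[OF C1_has_derivative[OF C1_en] C1_has_derivative[OF f], of x]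
  show ?thesis by (simp only:)
qed

lemmas C1_en_intros = C1_comp_intros C1_compose[OF C1_cut C1_en] C1_compose[OF C1_wt C1_en] C1_compose[OF C1_isq C1_en]

lemma en_invariant: "l \<in> L \<Longrightarrow> en (x + (l, 0)) = en x"
  by (simp add: en_def)

text \<open>The vector field \<open>wt \<cdot> X\<close> on the unit energy level, extended homogeneously along the rays. It is
  divergence free, which replaces Liouville's theorem for the energy level.\<close>

definition scaled_vf :: "'n phase \<Rightarrow> 'n phase" where
  "scaled_vf x = ((cut (en x) * lam (fst x)) *\<^sub>R snd x,
     (wt (en x) * lam (fst x)) *\<^sub>R (B (fst x) *v snd x) - (cut (en x) * ((snd x \<bullet> snd x) * (1 / 2))) *\<^sub>R G (fst x))"

definition normalize :: "'n phase \<Rightarrow> 'n phase" where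
  "normalize x = (fst x, isq (en x) *\<^sub>R snd x)"

lemma C1_normalize: "C1 normalize"
  unfolding normalize_def by (intro C1_en_intros)

lemma scaled_vf_admissible: "admissible scaled_vf"
  unfolding admissible_def
proof (intro conjI allI impI)
  show "C1 scaled_vf" unfolding scaled_vf_def by (intro C1_en_intros)
  show "invariant scaled_vf"
    by (simp add: invariant_def scaled_vf_def en_invariant B_periodic G_periodic)
  show "en x \<ge> 3 \<Longrightarrow> scaled_vf x = 0" for x
    by (simp add: scaled_vf_def wt_support prod_eq_iff)
qed

lemma D_en_scaled_vf: "D en x (scaled_vf x) = 0"
  using D_en[of "fst x" "snd x" "fst (scaled_vf x)" "snd (scaled_vf x)"]
  by (simp add: scaled_vf_def inner_diff_right inner_commute)

text \<open>Since \<open>scaled_vf\<close> is tangent to the energy levels, the scaling factor of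
  \<open>normalize\<close> is constant along it. The identity \<open>wt_isq\<close> then matches
  both components: up to the weight, the field is a lift of \<open>X\<close> through the projection
  along rays.\<close>

lemma D_normalize_scaled_vf: "D normalize x (scaled_vf x) = wt (en x) *\<^sub>R X (normalize x)"
proof -
  have "(normalize has_derivative (\<lambda>w. (fst w, isq (en x) *\<^sub>R snd w + (D en x w * D isq (en x) 1) *\<^sub>R snd x))) (at x)"
    unfolding normalize_def
    by (intro has_derivative_Pair has_derivative_scaleR has_derivative_comp_en C1_isq has_derivative_fst has_derivative_snd has_derivative_ident)
  from D_eq[OF this] have "D normalize x (scaled_vf x) = (fst (scaled_vf x), isq (en x) *\<^sub>R snd (scaled_vf x))"
    by (simp add: D_en_scaled_vf)
  also have "\<dots> = wt (en x) *\<^sub>R X (normalize x)"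
    by (simp add: scaled_vf_def magnetic_vf_def normalize_def wt_isq[symmetric] matrix_vector_mult_scaleR
       scaleR_diff_right power2_eq_square mult_ac)
  finally show ?thesis .
qed

text \<open>The part without \<open>B\<close> is \<open>cut (en x)\<close> times the untwisted
  Hamiltonian field, which is divergence free and preserves \<open>en\<close>. The magnetic part
  contributes only the trace of \<open>B\<close> and multiples of
  \<open>p \<bullet> (B q *v p)\<close>, and both vanish by skewness.\<close>

lemma divg_scaled_vf: "divg scaled_vf x = 0"
proof -
  obtain q p where x: "x = (q, p)" by fastforce
  define c' where "c' = D cut (en x) 1" define w' where "w' = D wt (en x) 1"
  have DE: "D en x w = 2 * lam q * (p \<bullet> snd w) + (G q \<bullet> fst w) * (p \<bullet> p)" for w
    using D_en[of q p "fst w" "snd w"] by (simp add: x)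
  note c = has_derivative_comp_en[OF C1_cut, of x] and w = has_derivative_comp_en[OF C1_wt, of x]
    and l = has_derivative_comp_fst[OF C1_lam, of x] and g = has_derivative_comp_fst[OF C1_G, of x]
    and p = has_derivative_snd[OF has_derivative_ident[of "at x"]]
    and m = bounded_bilinear.FDERIV[OF bounded_bilinear_matrix_vector_mult has_derivative_comp_fst[OF C1_B, of x]
        has_derivative_snd[OF has_derivative_ident[of "at x"]]]
  have "(scaled_vf has_derivative (\<lambda>w. 
     ((cut (en x) * lam q) *\<^sub>R snd w + (cut (en x) * D lam q (fst w) + (D en x w * c') * lam q) *\<^sub>R p,
      ((wt (en x) * lam q) *\<^sub>R (B q *v snd w + D B q (fst w) *v p) + (wt (en x) * D lam q (fst w) + (D en x w * w') * lam q) *\<^sub>R (B q *v p))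
      - ((cut (en x) * ((p \<bullet> p) * (1 / 2))) *\<^sub>R D G q (fst w) 
         + (cut (en x) * ((p \<bullet> snd w + snd w \<bullet> p) * (1 / 2)) + (D en x w * c') * ((p \<bullet> p) * (1 / 2))) *\<^sub>R G q)))) (at x)"
    unfolding scaled_vf_def
    by (rule has_derivative_Pair[OF has_derivative_scaleR[OF has_derivative_mult[OF c l] p] has_derivative_diff[OF 
        has_derivative_scaleR[OF has_derivative_mult[OF w l] m] 
        has_derivative_scaleR[OF has_derivative_mult[OF c has_derivative_mult_left[OF has_derivative_inner[OF p p], of "1 / 2"]] g]],
        THEN has_derivative_eq_rhs])
      (simp add: fun_eq_iff x c'_def w'_def)
  from D_eq[OF this] have DV: "fst (D scaled_vf x w) = (cut (en x) * lam q) *\<^sub>R snd w + (cut (en x) * D lam q (fst w) + (D en x w * c') * lam q) *\<^sub>R p"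
    "snd (D scaled_vf x w) = ((wt (en x) * lam q) *\<^sub>R (B q *v snd w + D B q (fst w) *v p) + (wt (en x) * D lam q (fst w) + (D en x w * w') * lam q) *\<^sub>R (B q *v p))
      - ((cut (en x) * ((p \<bullet> p) * (1 / 2))) *\<^sub>R D G q (fst w) 
         + (cut (en x) * ((p \<bullet> snd w + snd w \<bullet> p) * (1 / 2)) + (D en x w * c') * ((p \<bullet> p) * (1 / 2))) *\<^sub>R G q)" for w
    by simp_all
  have lam0: "D lam q 0 = 0" "D B q 0 = 0" "D G q 0 = 0"
    by (simp_all add: linear_0 linear_D C1_lam C1_B C1_G)
  have Bii: "(B q *v axis i 1) $ i = 0" for i
  proof -
    have "(B q *v axis i 1) $ i = axis i 1 \<bullet> (B q *v axis i 1)"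
      by (simp only: inner_axis' inner_real_def mult_1)
    also have "\<dots> = 0" by (rule B_inner_self)
    finally show ?thesis .
  qed
  have "fst (D scaled_vf x (axis i 1, 0)) $ i + snd (D scaled_vf x (0, axis i 1)) $ i 
      = (2 * (lam q)\<^sup>2 * w') * (p $ i * (B q *v p) $ i)" for i
    unfolding DV DE by (simp add: lam0 Bii grad_inner[OF C1_lam, symmetric] inner_axis inner_axis' power2_eq_square algebra_simps)
  then have "divg scaled_vf x = (2 * (lam q)\<^sup>2 * w') * (p \<bullet> (B q *v p))"
    by (simp add: divg_def inner_vec_def sum_distrib_left)
  then show ?thesis by simp
qed

section \<open>The mean of the potential\<close>

definition conf :: "'n phase \<Rightarrow> real" where
  "conf x = (G (fst x) \<bullet> G (fst x)) / (lam (fst x))\<^sup>2"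

lemma wt_en_zero: "en x \<ge> 3 \<Longrightarrow> wt (en x) = 0" by (rule wt_support)

lemma C1_conf: "C1 conf"
  unfolding conf_def by (intro C1_comp_intros) simp

lemma continuous_wt: "continuous_on UNIV f \<Longrightarrow> continuous_on UNIV (\<lambda>x. wt (en x) * f x)"
  by (intro continuous_on_mult C1_continuous[OF C1_compose[OF C1_wt C1_en]])

lemma D_en_axis:
  "D en x (axis i 1, 0) = G (fst x) $ i * (snd x \<bullet> snd x)" "D en x (0, axis i 1) = 2 * lam (fst x) * snd x $ i"
  using D_en[of "fst x" "snd x" "axis i 1" 0] D_en[of "fst x" "snd x" 0 "axis i 1"]
  by (simp_all add: inner_axis)

lemma lap_eq: "(\<Sum>i\<in>UNIV. D G q (axis i 1) $ i) = lap q"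
  by (simp add: lap_def)

text \<open>Here \<open>conf\<close> is the squared Euclidean norm of the gradient of
  \<open>ln lam\<close>. The horizontal field \<open>W1\<close> has the wanted term in its
  divergence, together with a term \<open>P\<close> containing the derivative of \<open>wt\<close>.
  The radial field \<open>W2\<close> is chosen to reproduce \<open>P\<close>: the divergences are
  \<open>P - H + Q\<close> and \<open>2 * P + n * H\<close>, and eliminating the mean of
  \<open>P\<close> gives the identity.\<close>

lemma avg_lap:
  "avg (\<lambda>x. wt (en x) * (lap (fst x) / lam (fst x))) = (1 + real CARD('n) / 2) * avg (\<lambda>x. wt (en x) * conf x)"
proof -
  define w' where "w' x = D wt (en x) 1" for x
  define W1 where "W1 x = ((wt (en x) * inverse (lam (fst x))) *\<^sub>R G (fst x), 0 :: real ^ 'n)" for x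
  define W2 where "W2 x = (0 :: real ^ 'n, (wt (en x) * conf x) *\<^sub>R snd x)" for x
  have a1: "admissible W1"
    unfolding admissible_def
  proof (intro conjI allI impI)
    show "C1 W1" unfolding W1_def by (intro C1_en_intros) simp
  qed (auto simp: W1_def wt_en_zero invariant_def en_invariant G_periodic zero_prod_def)
  have a2: "admissible W2"
    unfolding admissible_def
  proof (intro conjI allI impI)
    show "C1 W2" unfolding W2_def by (intro C1_en_intros C1_conf)
  qed (auto simp: W2_def wt_en_zero invariant_def en_invariant G_periodic zero_prod_def conf_def)
  have d1: "divg W1 x = w' x * (snd x \<bullet> snd x) * lam (fst x) * conf x - wt (en x) * conf x + wt (en x) * (lap (fst x) / lam (fst x))" for x
  proof -
    let ?l = "lam (fst x)"
    have "(W1 has_derivative (\<lambda>w. ((wt (en x) * inverse ?l) *\<^sub>R D G (fst x) (fst w) 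
       + (wt (en x) * (- (inverse ?l * D lam (fst x) (fst w) * inverse ?l)) + (D en x w * w' x) * inverse ?l) *\<^sub>R G (fst x), 0))) (at x)"
      unfolding W1_def w'_def
      by (intro has_derivative_Pair has_derivative_const has_derivative_scaleR has_derivative_mult has_derivative_comp_en
          Deriv.has_derivative_inverse has_derivative_comp_fst C1_lam C1_G C1_wt) simp
    from D_eq[OF this] have DW: "D W1 x w = ((wt (en x) * inverse ?l) *\<^sub>R D G (fst x) (fst w) 
       + (wt (en x) * (- (inverse ?l * D lam (fst x) (fst w) * inverse ?l)) + (D en x w * w' x) * inverse ?l) *\<^sub>R G (fst x), 0)" for w
      by simp
    have Dl: "D lam (fst x) (axis i 1) = G (fst x) $ i" for i by (simp add: grad_def)
    have "divg W1 x = (\<Sum>i\<in>UNIV. (w' x * (snd x \<bullet> snd x) * inverse ?l - wt (en x) * (inverse ?l)\<^sup>2) * (G (fst x) $ i * G (fst x) $ i)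
        + (wt (en x) * inverse ?l) * D G (fst x) (axis i 1) $ i)"
      unfolding divg_def DW by (simp add: Dl D_en_axis power2_eq_square algebra_simps)
    also have "\<dots> = (w' x * (snd x \<bullet> snd x) * inverse ?l - wt (en x) * (inverse ?l)\<^sup>2) * (G (fst x) \<bullet> G (fst x))
        + (wt (en x) * inverse ?l) * lap (fst x)"
      by (simp add: sum.distrib sum_distrib_left[symmetric] inner_vec_def lap_eq)
    also have "\<dots> = w' x * (snd x \<bullet> snd x) * ?l * conf x - wt (en x) * conf x + wt (en x) * (lap (fst x) / ?l)"
      by (simp add: conf_def field_simps power2_eq_square)
    finally show ?thesis .
  qed
  have d2: "divg W2 x = 2 * (w' x * (snd x \<bullet> snd x) * lam (fst x) * conf x) + real CARD('n) * (wt (en x) * conf x)" for x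
  proof -
    have cx: "conf = (\<lambda>x. conf (fst x, 0))" by (simp add: fun_eq_iff conf_def)
    have "D conf x (0, v) = 0" for v
    proof -
      have "((\<lambda>x. conf (fst x, 0)) has_derivative (\<lambda>w. D conf (fst x, 0) (fst w, 0))) (at x)"
        by (rule has_derivative_compose[OF _ C1_has_derivative[OF C1_conf]])
           (intro has_derivative_Pair has_derivative_fst has_derivative_ident has_derivative_const)
      from D_eq[OF this] have "D conf x (0, v) = D conf (fst x, 0) 0"
        using cx by (simp add: zero_prod_def)
      then show ?thesis by (simp add: linear_0 linear_D C1_conf)
    qed
    moreover have "(W2 has_derivative (\<lambda>w. (0, (wt (en x) * conf x) *\<^sub>R snd w 
       + (wt (en x) * D conf x w + (D en x w * w' x) * conf x) *\<^sub>R snd x))) (at x)"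
      unfolding W2_def w'_def
      by (intro has_derivative_Pair has_derivative_const has_derivative_scaleR has_derivative_mult has_derivative_comp_en
          has_derivative_snd has_derivative_ident C1_has_derivative C1_conf C1_wt)
    from D_eq[OF this] have DW: "D W2 x w = (0, (wt (en x) * conf x) *\<^sub>R snd w 
       + (wt (en x) * D conf x w + (D en x w * w' x) * conf x) *\<^sub>R snd x)" for w by simp
    ultimately have "divg W2 x = (\<Sum>i\<in>UNIV. (2 * w' x * lam (fst x) * conf x) * (snd x $ i * snd x $ i) + wt (en x) * conf x)"
      unfolding divg_def DW by (simp add: D_en_axis algebra_simps)
    also have "\<dots> = (2 * w' x * lam (fst x) * conf x) * (snd x \<bullet> snd x) + real CARD('n) * (wt (en x) * conf x)"
      by (simp add: sum.distrib sum_distrib_left[symmetric] inner_vec_def)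
    finally show ?thesis by (simp add: algebra_simps)
  qed
  define P where "P = (\<lambda>x. w' x * (snd x \<bullet> snd x) * lam (fst x) * conf x)"
  define H where "H = (\<lambda>x. wt (en x) * conf x)"
  define Q where "Q = (\<lambda>x. wt (en x) * (lap (fst x) / lam (fst x)))"
  have cH: "continuous_on UNIV H"
    unfolding H_def by (intro continuous_wt C1_continuous C1_conf)
  have cQ: "continuous_on UNIV Q"
    unfolding Q_def by (intro continuous_wt C1_continuous C1_comp_intros C1_compose[OF C1_lap]) simp
  have "continuous_on UNIV w'"
    unfolding w'_def by (intro continuous_on_D[OF C1_wt] C1_continuous C1_en C1_const)
  moreover have "continuous_on UNIV (\<lambda>x. (snd x \<bullet> snd x) * lam (fst x) * conf x :: real)"
    by (intro C1_continuous C1_comp_intros C1_conf)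
  ultimately have cP: "continuous_on UNIV P"
    unfolding P_def mult.assoc by (rule continuous_on_mult)
  have "avg (\<lambda>x. P x - H x + Q x) = 0"
  proof -
    have "divg W1 = (\<lambda>x. P x - H x + Q x)" by (rule ext) (simp only: d1 P_def H_def Q_def)
    then show ?thesis using avg_divg[OF a1] by (simp only:)
  qed
  moreover have "avg (\<lambda>x. 2 * P x + real CARD('n) * H x) = 0"
  proof -
    have "divg W2 = (\<lambda>x. 2 * P x + real CARD('n) * H x)" by (rule ext) (simp only: d2 P_def H_def Q_def)
    then show ?thesis using avg_divg[OF a2] by (simp only:)
  qed
  ultimately have "avg P - avg H + avg Q = 0" "2 * avg P + real CARD('n) * avg H = 0"
    by (simp_all add: avg_add avg_diff avg_cmult cP cH cQ continuous_on_diff continuous_on_mult_left)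
  then show ?thesis unfolding Q_def[symmetric] H_def[symmetric] by (simp add: algebra_simps)
qed

lemma continuous_pot_normalize: "continuous_on UNIV (\<lambda>x. pot (\<Phi> t (normalize x)))"
  by (intro C1_continuous C1_compose[OF C1_pot] C1_compose[OF C1_flow] C1_normalize)

text \<open>The odd part is linear in the momentum and averages to zero. By \<open>avg_lap\<close>
  the terms in the derivatives of \<open>lam\<close> combine to \<open>n / 4 - 1 / 2\<close> times
  the mean of \<open>conf\<close>, which is nonnegative for \<open>n \<ge> 2\<close>.\<close>

lemma avg_pot_ge:
  assumes n: "CARD('n) \<ge> 2"
  shows "avg (\<lambda>x. wt (en x) * (lam (fst x) / 4 * form_sq (fst x))) \<le> avg (\<lambda>x. wt (en x) * pot (normalize x))"
proof -
  let ?F = "\<lambda>x. wt (en x) * (lam (fst x) / 4 * form_sq (fst x))"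
  let ?Q = "\<lambda>x. wt (en x) * (lap (fst x) / lam (fst x))"
  let ?H = "\<lambda>x. wt (en x) * conf x"
  let ?O = "\<lambda>x. wt (en x) * odd_part (normalize x)"
  have c: "continuous_on UNIV ?F" "continuous_on UNIV ?Q" "continuous_on UNIV ?H" "continuous_on UNIV ?O"
    unfolding form_sq_def
    by (intro continuous_wt C1_continuous C1_comp_intros C1_compose[OF C1_lap] C1_conf C1_compose[OF C1_odd_part C1_normalize]; simp)+
  have "wt (en x) * pot (normalize x) = ?F x + (1 / 2) * ?Q x - ?H x - ?O x" for x
    by (simp add: pot_def conf_def normalize_def algebra_simps)
  then have "avg (\<lambda>x. wt (en x) * pot (normalize x)) = avg (\<lambda>x. ?F x + (1 / 2) * ?Q x - ?H x - ?O x)" by simp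
  also have "\<dots> = avg ?F + (1 / 2) * avg ?Q - avg ?H - avg ?O"
    by (simp only: avg_add avg_diff avg_cmult c continuous_on_add continuous_on_diff continuous_on_mult_left)
  also have "avg ?O = 0"
  proof (rule avg_odd[OF c(4)])
    show "wt (en (q, - p)) * odd_part (normalize (q, - p)) = - (wt (en (q, p)) * odd_part (normalize (q, p)))" for q p
      by (simp add: en_def normalize_def odd_part_def matrix_vector_mult_scaleR sum_negf vector_scalar_mult_def algebra_simps
        linear_neg[OF matrix_vector_mul_linear])
  qed
  also have "avg ?F + (1 / 2) * avg ?Q - avg ?H - 0 = avg ?F + (real CARD('n) / 4 - 1 / 2) * avg ?H"
    unfolding avg_lap by (simp add: field_simps)
  also have "\<dots> \<ge> avg ?F"
  proof -
    have "avg (\<lambda>x. 0) \<le> avg ?H"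
      by (rule avg_mono[OF continuous_on_const c(3)], intro mult_nonneg_nonneg wt_nonneg)
         (simp_all add: conf_def en_def lam_pos less_imp_le)
    then have "0 \<le> avg ?H" by (simp add: avg_def)
    then show ?thesis using n by simp
  qed
  finally show ?thesis .
qed

text \<open>A lattice translation moves the point into the fundamental cell, and a continuous
  nonnegative function with zero integral over a box vanishes on it.\<close>

lemma avg_pos:
  assumes f: "continuous_on UNIV f" "\<And>x. f x \<ge> 0" "invariant f" and x: "en x < 3" "f x > 0"
  shows "avg f > 0"
proof -
  obtain s l where s: "s \<in> cbox 0 1" "l \<in> L" "cell s = fst x + l"
    by (rule lattice_cell[OF cell_linear cell_surj cell_lattice, of "fst x"])
  define y where "y = (s, snd x)"
  have cy: "chart y = x + (l, 0)" by (simp add: chart_def y_def s prod_eq_iff)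
  have y: "y \<in> cbox lo hi"
  proof -
    have "\<bar>snd x $ i\<bar> \<le> rad" for i using momentum_bound[of x i] x by simp
    then have "snd x \<in> cbox (\<chi> i. - rad) (\<chi> i. rad)" by (auto simp: mem_box_cart abs_le_iff minus_le_iff)
    then show ?thesis using s(1) by (simp add: y_def lo_def hi_def cbox_Pair_eq)
  qed
  have box: "box lo hi \<noteq> {}"
    using rad_ge by (auto simp: lo_def hi_def box_ne_empty Basis_prod_def inner_Basis_inf_left Basis_vec_def inner_axis)
  have "f (chart y) > 0" using f(3) x(2) s(2) unfolding cy invariant_def by metis
  then have "integral (cbox lo hi) (\<lambda>y. f (chart y)) \<noteq> 0"
    using integral_cbox_eq_0_iff[of lo hi "\<lambda>y. f (chart y)"] continuous_on_chart[OF f(1)] box f(2) y by fastforce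
  moreover have "avg (\<lambda>x. 0) \<le> avg f" by (rule avg_mono) (auto intro: f)
  ultimately show ?thesis by (simp add: avg_def)
qed

text \<open>The time derivative of the weighted integrand equals its derivative along
  \<open>scaled_vf\<close>, because the flow carries \<open>X\<close> to itself; that derivative has
  mean zero since the field is divergence free.\<close>

lemma avg_flow_constant:
  "avg (\<lambda>x. wt (en x) * pot (\<Phi> t (normalize x))) = avg (\<lambda>x. wt (en x) * pot (normalize x))"
proof -
  define R where "R z = pot (\<Phi> (fst z) (normalize (snd z)))" for z :: "real \<times> 'n phase"
  have C1R: "C1 R"
    unfolding R_def by (intro C1_compose[OF C1_pot] C1_flow_comp C1_compose[OF C1_normalize] C1_intros)
  define J where "J t = avg (\<lambda>x. wt (en x) * R (t, x))" for t
  define R' where "R' t x = D pot (\<Phi> t (normalize x)) (X (\<Phi> t (normalize x)))" for t x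
  have R't: "((\<lambda>t. R (t, x)) has_vector_derivative R' t x) (at t within S)" for t x S
    unfolding R_def R'_def fst_conv snd_conv
    by (rule has_vector_derivative_comp_C1[OF C1_pot has_vector_derivative_at_within[OF flow_deriv]])
  have R'x: "wt (en x) * R' t x = D (\<lambda>x. R (t, x)) x (scaled_vf x)" for t x
  proof -
    have "((\<lambda>x. R (t, x)) has_derivative (\<lambda>w. D pot (\<Phi> t (normalize x)) (D (\<Phi> t) (normalize x) (D normalize x w)))) (at x)"
      unfolding R_def fst_conv snd_conv
      by (rule has_derivative_compose[OF has_derivative_compose[OF C1_has_derivative[OF C1_normalize] C1_has_derivative[OF C1_flow]]
          C1_has_derivative[OF C1_pot]])
    from D_eq[OF this] have "D (\<lambda>x. R (t, x)) x (scaled_vf x) 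
        = D pot (\<Phi> t (normalize x)) (D (\<Phi> t) (normalize x) (wt (en x) *\<^sub>R X (normalize x)))"
      by (simp add: D_normalize_scaled_vf)
    then show ?thesis
      by (simp add: linear_scale[OF linear_D[OF C1_flow]] linear_scale[OF linear_D[OF C1_pot]] D_flow_X R'_def)
  qed
  have inv: "invariant (\<lambda>x. R (t, x))" for t
  proof -
    have "pot (y + (l, 0)) = pot y" if "l \<in> L" for l y
      using that by (simp add: pot_def form_sq_def lap_def odd_part_def B_periodic G_periodic
          D_periodic[OF C1_B] D_periodic[OF C1_G])
    moreover have "normalize (x + (l, 0)) = normalize x + (l, 0)" if "l \<in> L" for l x
      using that by (simp add: normalize_def en_invariant)
    ultimately show ?thesis by (simp add: invariant_def R_def flow_periodic)
  qed
  have "(J has_vector_derivative 0) (at t)" for t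
  proof -
    have cR': "continuous_on UNIV (\<lambda>(t, y). wt (en (chart y)) * R' t (chart y))"
      unfolding R'_def split_beta
      by (intro continuous_on_mult C1_continuous[OF C1_compose[OF C1_wt C1_compose[OF C1_en C1_compose[OF C1_chart C1_snd[OF C1_ident]]]]]
         continuous_on_D[OF C1_pot] C1_continuous[OF C1_compose[OF C1_X]] C1_continuous C1_flow_comp
         C1_compose[OF C1_X] C1_compose[OF C1_normalize] C1_compose[OF C1_chart] C1_intros)
    have "(J has_vector_derivative integral (cbox lo hi) (\<lambda>y. wt (en (chart y)) * R' t (chart y))) (at t within UNIV)"
      unfolding J_def avg_def
    proof (rule leibniz_rule_vector_derivative)
      show "((\<lambda>t. wt (en (chart y)) * R (t, chart y)) has_vector_derivative wt (en (chart y)) * R' t (chart y)) (at t within UNIV)" for t y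
        using has_vector_derivative_mult_right[OF R't] .
      show "(\<lambda>y. wt (en (chart y)) * R (t, chart y)) integrable_on cbox lo hi" for t
        unfolding R_def fst_conv snd_conv
        by (rule avg_integrable[of "\<lambda>x. wt (en x) * pot (\<Phi> t (normalize x))"]) (rule continuous_wt[OF continuous_pot_normalize])
      show "continuous_on (UNIV \<times> cbox lo hi) (\<lambda>(t, y). wt (en (chart y)) * R' t (chart y))"
        using cR' continuous_on_subset by blast
    qed auto
    also have "integral (cbox lo hi) (\<lambda>y. wt (en (chart y)) * R' t (chart y)) = avg (\<lambda>x. D (\<lambda>x. R (t, x)) x (scaled_vf x))"
      by (simp add: avg_def R'x)
    also have "\<dots> = 0"
      using avg_divergence[OF scaled_vf_admissible C1_compose[OF C1R C1_Pair[OF C1_const C1_ident]] inv, of t]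
      by (simp add: divg_scaled_vf)
    finally show ?thesis .
  qed
  from has_zero_derivative_const[OF this, of t] show ?thesis by (simp add: J_def R_def)
qed

section \<open>Conclusion of Hopf's argument\<close>

lemma en_normalize: "cut (en x) \<noteq> 0 \<Longrightarrow> en (normalize x) = 1"
  using isq_sq[of "en x"] cut_nonzero[of "en x"] by (simp add: en_def normalize_def power2_eq_square algebra_simps)

lemma exists_conjugate_point:
  assumes n: "CARD('n) \<ge> 2" and B: "B q0 \<noteq> 0"
  shows "\<exists>x. en x = 1 \<and> \<not> no_conj x"
proof (rule ccontr)
  assume "\<not> (\<exists>x. en x = 1 \<and> \<not> no_conj x)"
  then have nc: "\<And>x. en x = 1 \<Longrightarrow> no_conj x" by blast
  obtain c K where c: "c > 0" "K \<ge> 0" and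
    oi: "\<And>x T. no_conj x \<Longrightarrow> en x = 1 \<Longrightarrow> T > 0 \<Longrightarrow>
       integral {1..1 + T} (\<lambda>t. ((t - 1) * (1 + T - t))\<^sup>2 * pot (\<Phi> t x)) \<le> T ^ 3 / c + K * T ^ 4 / 2"
    by (rule orbit_inequality) blast
  define J where "J = avg (\<lambda>x. wt (en x) * pot (normalize x))"
  define W where "W = avg (\<lambda>x. wt (en x))"
  have Jpos: "J > 0"
  proof -
    define f where "f x = wt (en x) * (lam (fst x) / 4 * form_sq (fst x))" for x
    obtain i j where ij: "B q0 $ i $ j \<noteq> 0" using B by (auto simp: vec_eq_iff)
    \<comment> \<open>Any momentum over \<open>q0\<close> with energy 2 would do: this is the middle
      of the support of the bump, where \<open>cut\<close> equals 1.\<close>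
    define x where "x = (q0, axis i (sqrt (2 / lam q0)))"
    have ex: "en x = 2"
      using lam_pos[of q0] by (simp add: x_def en_def inner_axis_axis)
    have "(B q0 $ i $ j)\<^sup>2 \<le> (\<Sum>j\<in>UNIV. (B q0 $ i $ j)\<^sup>2)" by (rule member_le_sum) auto
    also have "\<dots> \<le> form_sq q0"
      unfolding form_sq_def by (rule member_le_sum) (auto intro: sum_nonneg)
    finally have "form_sq q0 > 0" using ij by (smt (verit) zero_less_power2)
    then have fx: "f x > 0"
      using lam_pos[of q0] isq_pos[of 2] by (simp add: f_def ex wt_def cut_2, simp add: x_def)
    have "avg f > 0"
    proof (rule avg_pos[of f x])
      show "continuous_on UNIV f"
        unfolding f_def form_sq_def by (intro continuous_wt C1_continuous C1_comp_intros) simp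
      show "f x \<ge> 0" for x
        using lam_pos by (auto simp: f_def form_sq_def en_def less_imp_le intro!: mult_nonneg_nonneg wt_nonneg sum_nonneg)
      show "invariant f" by (simp add: invariant_def f_def en_invariant form_sq_def B_periodic)
    qed (simp_all add: ex fx)
    also have "avg f \<le> J" unfolding J_def f_def by (rule avg_pot_ge[OF n])
    finally show ?thesis .
  qed
  \<comment> \<open>The orbit inequality is integrated over all starting points. Exchanging the
    integrals and using \<open>avg_flow_constant\<close> turns the left side into \<open>J\<close>
    times the integral of the squared test function.\<close>
  have main: "J * T ^ 5 / 30 \<le> (T ^ 3 / c + K * T ^ 4 / 2) * W" if T: "T > 0" for T
  proof -
    define \<phi> where "\<phi> t = ((t - 1) * (1 + T - t))\<^sup>2" for t :: real
    define h where "h t x = \<phi> t * (wt (en x) * pot (\<Phi> t (normalize x)))" for t x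
    have ch: "continuous_on UNIV (\<lambda>(t, y). h t (chart y))"
      unfolding h_def \<phi>_def split_beta
      by (intro C1_continuous C1_compose[OF C1_pot] C1_flow_comp C1_compose[OF C1_normalize] C1_compose[OF C1_wt]
         C1_compose[OF C1_en] C1_compose[OF C1_chart] C1_intros)
    have "integral (cbox 1 (1 + T)) (\<lambda>t. integral (cbox lo hi) (\<lambda>y. h t (chart y))) =
       integral (cbox lo hi) (\<lambda>y. integral (cbox 1 (1 + T)) (\<lambda>t. h t (chart y)))"
      by (rule integral_swap_continuous) (use ch continuous_on_subset in blast)
    moreover have "integral (cbox lo hi) (\<lambda>y. h t (chart y)) = \<phi> t * J" for t
      using avg_flow_constant[of t] unfolding h_def J_def avg_def by simp
    moreover have "integral (cbox 1 (1 + T)) (\<lambda>t. \<phi> t * J) = J * T ^ 5 / 30"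
    proof -
      \<comment> \<open>With \<open>s = t - 1\<close>, an antiderivative of
        \<open>T\<^sup>2 * s\<^sup>2 - 2 * T * s ^ 3 + s ^ 4\<close>; at \<open>s = T\<close> its
        value is \<open>(1 / 3 - 1 / 2 + 1 / 5) * T ^ 5\<close>.\<close>
      define F where "F t = T\<^sup>2 * (t - 1) ^ 3 / 3 - T * (t - 1) ^ 4 / 2 + (t - 1) ^ 5 / 5" for t :: real
      have "(F has_real_derivative \<phi> t) (at t within {1..1 + T})" for t
        unfolding F_def \<phi>_def
        by (auto intro!: derivative_eq_intros) (simp add: power2_eq_square power3_eq_cube power4_eq_xxxx field_simps)
      then have "(\<phi> has_integral (F (1 + T) - F 1)) {1..1 + T}"
        using T by (intro fundamental_theorem_of_calculus) (auto simp: has_real_derivative_iff_has_vector_derivative)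
      moreover have "F (1 + T) - F 1 = T ^ 5 / 30"
        by (simp add: F_def power2_eq_square power3_eq_cube power4_eq_xxxx eval_nat_numeral field_simps)
      ultimately show ?thesis by (simp add: integral_unique mult.commute)
    qed
    moreover have "integral (cbox lo hi) (\<lambda>y. integral (cbox 1 (1 + T)) (\<lambda>t. h t (chart y)))
       \<le> integral (cbox lo hi) (\<lambda>y. (T ^ 3 / c + K * T ^ 4 / 2) * wt (en (chart y)))"
    proof (rule integral_le)
      have sw: "continuous_on (UNIV \<times> cbox 1 (1 + T)) (\<lambda>z :: 'n phase \<times> real. (snd z, fst z))"
        by (intro continuous_intros)
      have "continuous_on (UNIV \<times> cbox 1 (1 + T)) (\<lambda>(y, t). h t (chart y))"
        using continuous_on_UNIV_compose[OF ch, of "UNIV \<times> cbox 1 (1 + T)" "\<lambda>z. (snd z, fst z)"]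
          sw by (simp add: split_beta)
      from integral_continuous_on_param[OF this]
      show "(\<lambda>y. integral (cbox 1 (1 + T)) (\<lambda>t. h t (chart y))) integrable_on cbox lo hi"
        by (intro integrable_continuous) (rule continuous_on_subset, auto)
      show "(\<lambda>y. (T ^ 3 / c + K * T ^ 4 / 2) * wt (en (chart y))) integrable_on cbox lo hi"
        by (intro integrable_on_mult_right avg_integrable[of "\<lambda>x. wt (en x)"] C1_continuous C1_compose[OF C1_wt C1_en])
      fix y
      let ?x = "chart y"
      have "integral (cbox 1 (1 + T)) (\<lambda>t. h t ?x) = wt (en ?x) * integral {1..1 + T} (\<lambda>t. \<phi> t * pot (\<Phi> t (normalize ?x)))"
        unfolding h_def by (simp add: mult.left_commute[of "\<phi> _"])
      \<comment> \<open>Where \<open>cut\<close> vanishes the weight makes both sides 0; elsewhere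
        the normalized point lies on the level to which the orbit inequality applies.\<close>
      also have "\<dots> \<le> wt (en ?x) * (T ^ 3 / c + K * T ^ 4 / 2)"
      proof (cases "cut (en ?x) = 0")
        case False
        then have e: "en (normalize ?x) = 1" by (rule en_normalize)
        have "wt (en ?x) \<ge> 0" using cut_nonzero[OF False] by (intro wt_nonneg) simp
        then show ?thesis
          using oi[OF nc[OF e] e T] unfolding \<phi>_def by (rule mult_left_mono[rotated])
      qed (simp add: wt_def)
      finally show "integral (cbox 1 (1 + T)) (\<lambda>t. h t (chart y)) \<le> (T ^ 3 / c + K * T ^ 4 / 2) * wt (en (chart y))"
        by (simp add: mult.commute)
    qed
    ultimately have "J * T ^ 5 / 30 \<le> integral (cbox lo hi) (\<lambda>y. (T ^ 3 / c + K * T ^ 4 / 2) * wt (en (chart y)))"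
      by (simp only:)
    then show ?thesis by (simp only: W_def avg_def integral_mult_right)
  qed
  have W0: "W \<ge> 0"
  proof -
    have "en x \<ge> 0" for x by (simp add: en_def lam_pos less_imp_le)
    then have "avg (\<lambda>x. 0) \<le> W"
      unfolding W_def by (intro avg_mono continuous_on_const C1_continuous[OF C1_compose[OF C1_wt C1_en]] wt_nonneg)
    then show ?thesis by (simp add: avg_def)
  qed
  define M where "M = (1 / c + K / 2) * W"
  \<comment> \<open>One more than the largest length allowed by \<open>J * T / 30 \<le> M\<close>;
    the added 1 also gives \<open>T \<ge> 1\<close>, so that \<open>T ^ 3\<close> can be absorbed
    into \<open>T ^ 4\<close>.\<close>
  define T where "T = 30 * M / J + 1"
  have "M \<ge> 0" using c W0 by (simp add: M_def)
  then have T: "T \<ge> 1" using Jpos by (simp add: T_def)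
  have "T ^ 3 / c \<le> T ^ 4 * (1 / c)"
    using T c power_increasing[of 3 4 T] by (simp add: divide_right_mono)
  then have "T ^ 3 / c + K * T ^ 4 / 2 \<le> T ^ 4 * (1 / c + K / 2)" by (simp add: algebra_simps)
  from mult_right_mono[OF this W0] have "(T ^ 3 / c + K * T ^ 4 / 2) * W \<le> T ^ 4 * M"
    by (simp only: M_def mult.assoc)
  then have "J * T ^ 5 / 30 \<le> T ^ 4 * M" using main[of T] T by linarith
  then have "T ^ 4 * (J * T / 30) \<le> T ^ 4 * M" by (simp add: eval_nat_numeral mult_ac)
  then have "J * T / 30 \<le> M" using T by simp
  then show False using Jpos mult_pos_pos[OF Jpos Jpos] by (simp add: T_def field_simps)
qed

end

theorem theorem1:
  fixes L :: "(real ^ 'n::finite) set"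
    and g \<beta> :: "'n::finite tensor2"
    and \<Phi> :: "real \<Rightarrow> 'n phase \<Rightarrow> 'n phase"
  assumes "lattice L"
    and "riemannian_metric L g"
    and "conformally_flat L g"
    and "two_form L \<beta>"
    and "closed_form \<beta>"
    and "magnetic_geodesic_flow g \<beta> \<Phi>"
    and "\<exists>q u v. \<beta> q u v \<noteq> 0"
  shows "\<exists>x. kinetic_energy g x = 1 / 2 \<and> has_conjugate_points \<Phi> (orbit \<Phi> x)"
proof -
  obtain lam :: "real ^ 'n \<Rightarrow> real" where lam: "smooth lam" "periodic L lam" "\<And>q. lam q > 0"
    and g: "\<And>q u v. g q u v = (1 / lam q) * (u \<bullet> v)"
    using assms(3) unfolding conformally_flat_def by blast
  have bil: "bilinear (\<beta> q)" for q using assms(4) by (auto simp: two_form_def smooth_tensor2_def)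
  have "is_flow (magnetic_vf lam \<beta>) \<Phi>"
    using assms(6) unfolding magnetic_geodesic_flow_def hamiltonian_vf_conformal[OF smooth_C1[OF lam(1)] lam(3) g bil] .
  then interpret conformal_magnetic L lam \<beta> \<Phi>
    using assms(1,4,5) lam by unfold_locales auto
  obtain m where m: "m > 0" "\<And>q. m \<le> lam q" using lam_lower_bound by blast
  obtain A :: "real ^ 'n \<Rightarrow> real ^ 'n" where A: "linear A" "surj A" "\<forall>s. (\<forall>i. s $ i \<in> \<int>) \<longrightarrow> A s \<in> L"
    using lattice_linear[OF assms(1)] by blast
  interpret conformal_magnetic_cell L lam \<beta> \<Phi> A m
    by (intro conformal_magnetic_cell.intro conformal_magnetic_axioms conformal_magnetic_cell_axioms.intro m A)
  obtain q u v where b: "\<beta> q u v \<noteq> 0" using assms(7) by blast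
  then have "u \<bullet> (form_matrix \<beta> q *v v) \<noteq> 0" by (simp add: form_matrix_inner[OF bil])
  then have Bq: "form_matrix \<beta> q \<noteq> 0" by auto
  \<comment> \<open>In dimension one every alternating form is zero, so the nonvanishing of
    \<open>\<beta>\<close> supplies the dimension bound.\<close>
  have "CARD('n) \<ge> 2"
  proof (rule ccontr)
    assume "\<not> CARD('n) \<ge> 2"
    then have "CARD('n) = 1" using zero_less_card_finite[where 'a='n] by linarith
    then obtain k where k: "(UNIV :: 'n set) = {k}" using card_1_singletonE by blast
    have "form_matrix \<beta> q $ i $ j = 0" for i j
    proof -
      have "i = k" "j = k" using k by auto
      then show ?thesis using assms(4) by (simp add: form_matrix_def two_form_def)
    qed
    then show False using Bq by (simp add: vec_eq_iff)
  qed
  then obtain x where x: "en x = 1" "\<not> no_conj x"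
    using exists_conjugate_point[OF _ Bq] by blast
  have "kinetic_energy g x = 1 / 2"
    using kinetic_energy_conformal[of lam x g, OF lam(3) g] x(1) by (simp add: en_def)
  moreover have "x \<in> orbit \<Phi> x" unfolding orbit_def by (rule image_eqI[of _ _ 0]) simp_all
  ultimately show ?thesis
    using x(2) unfolding has_conjugate_points_def no_conj_def by blast
qed

end
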